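(* Let $X=\mathbb P^2$, $G=SL_3$. Let $\delta=\sum_I\lambda_I\frac{\partial}{\partial a_I}$ be a homogeneous first order constant coefficient differential operator whose associated cubic form $h=\sum_I\lambda_Ix^I\in V^\vee$ is GIT-stable (i.e. in this case, smooth). Then for each smooth section $f(b)$, $b\in B$, one has $\mathcal N(\delta)\cap G\cdot f(b)\ne\emptyset$, where $G\cdot f(b)$ denotes the $G$-orbit of $f(b)$. In particular, $\mathcal N(\delta)\ne\emptyset$.
   Context: $V^\vee=\Gamma(\mathbb P^2,\mathcal O(3))$ is the space of ternary cubic forms in $x_1,x_2,x_3$ with its natural $SL_3$-action; $a_I$, $I=(ijk)$, $i+j+k=3$, are the linear coordinates on $V^\vee$ dual to the monomial basis $x^I=x_1^ix_2^jx_3^k$. For $b=(b_I)\in V^\vee$, $f(b)=\sum_Ib_Ix^I$ is the corresponding cubic (points $b$ of $V^\vee$ and cubics $f(b)$ are identified). $B\subset V^\vee$ is the set of cubics defining a smooth plane curve. The tautological system $\tau$ on $V^\vee$ for $X=\mathbb P^2$, $G=SL_3$: its solution sheaf $\mathrm{sol}(\tau)$ consists of holomorphic functions $s$ on $V^\vee$ such that $P\big((\partial/\partial a_I)_I\big)s=0$ for every polynomial $P$ in 10 variables with $P\big((x^I)_I\big)=0$ in $\mathbb C[x_1,x_2,x_3]$; $s$ is annihilated by the vector fields of the natural $\mathfrak{sl}_3$-action on $V^\vee$; and $(\sum_Ia_I\frac{\partial}{\partial a_I}+1)s=0$. For a differential operator $\delta$, $\mathcal N(\delta)=\{b\in B\mid\delta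 s(b)=0\ \ \forall s\in\mathrm{sol}(\tau)_b\}$. *)

theory Defs
  imports "HOL-Analysis.Analysis" "HOL-Library.Poly_Mapping"
begin

section \<open>Polynomials with complex coefficients\<close>

text \<open>A polynomial in variables indexed by \<open>'v\<close> maps each exponent vector \<open>'v \<Rightarrow>\<^sub>0 nat\<close> to its
  coefficient; the ring operations are those of \<^theory>\<open>HOL-Library.Poly_Mapping\<close>.\<close>

type_synonym 'v cpoly = "('v \<Rightarrow>\<^sub>0 nat) \<Rightarrow>\<^sub>0 complex"

definition cconst :: "complex \<Rightarrow> 'v cpoly" where
  "cconst c = Poly_Mapping.single 0 c"

definition cvar :: "'v \<Rightarrow> 'v cpoly" where
  "cvar v = Poly_Mapping.single (Poly_Mapping.single v 1) 1"

definition csubst :: "'v cpoly \<Rightarrow> ('v \<Rightarrow> 'w cpoly) \<Rightarrow> 'w cpoly" where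
  "csubst P q = (\<Sum>m\<in>Poly_Mapping.keys P. cconst (Poly_Mapping.lookup P m) *
      (\<Prod>v\<in>Poly_Mapping.keys m. q v ^ Poly_Mapping.lookup m v))"

definition ceval :: "'v cpoly \<Rightarrow> ('v \<Rightarrow> complex) \<Rightarrow> complex" where
  "ceval P x = (\<Sum>m\<in>Poly_Mapping.keys P. Poly_Mapping.lookup P m *
      (\<Prod>v\<in>Poly_Mapping.keys m. x v ^ Poly_Mapping.lookup m v))"

definition cpderiv :: "'v \<Rightarrow> 'v cpoly \<Rightarrow> 'v cpoly" where
  "cpderiv v P = (\<Sum>m\<in>Poly_Mapping.keys P. Poly_Mapping.single (m - Poly_Mapping.single v 1)
      (of_nat (Poly_Mapping.lookup m v) * Poly_Mapping.lookup P m))"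


section \<open>Ternary cubic forms\<close>

text \<open>The index type consists of the exponent vectors \<open>I = (i, j, k)\<close> with \<open>i + j + k = 3\<close>.\<close>

typedef cubic_idx = "{m :: 3 \<Rightarrow>\<^sub>0 nat. (\<Sum>i\<in>UNIV. Poly_Mapping.lookup m i) = 3}"
  morphisms expo Abs_cubic_idx
proof
  show "Poly_Mapping.single 1 3 \<in> {m :: 3 \<Rightarrow>\<^sub>0 nat. (\<Sum>i\<in>UNIV. Poly_Mapping.lookup m i) = 3}"
    by (simp add: lookup_single when_def)
qed

instance cubic_idx :: finite
proof
  let ?A = "PiE (UNIV :: 3 set) (\<lambda>_. {..3::nat})"
  let ?f = "\<lambda>I::cubic_idx. Poly_Mapping.lookup (expo I)"
  have "inj ?f"
    by (rule injI) (simp add: expo_inject)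
  moreover have "range ?f \<subseteq> ?A"
  proof (clarsimp simp: PiE_UNIV_domain Pi_def)
    fix I :: cubic_idx and i :: 3
    have "Poly_Mapping.lookup (expo I) i \<le> (\<Sum>i\<in>UNIV. Poly_Mapping.lookup (expo I) i)"
      by (rule member_le_sum) auto
    also have "\<dots> = 3"
      using expo [of I] by simp
    finally show "Poly_Mapping.lookup (expo I) i \<le> 3" .
  qed
  moreover have "finite ?A"
    by (rule finite_PiE) auto
  ultimately show "finite (UNIV :: cubic_idx set)"
    by (meson finite_imageD finite_subset)
qed

type_synonym cubic_space = "complex ^ cubic_idx"

definition xmon :: "cubic_idx \<Rightarrow> 3 cpoly" where
  "xmon I = Poly_Mapping.single (expo I) 1"

definition cubic_form :: "cubic_space \<Rightarrow> 3 cpoly" where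
  "cubic_form b = (\<Sum>I\<in>UNIV. cconst (b $ I) * xmon I)"

definition cubic_coeffs :: "3 cpoly \<Rightarrow> cubic_space" where
  "cubic_coeffs p = (\<chi> I. Poly_Mapping.lookup p (expo I))"

text \<open>Smoothness of the plane curve \<open>f(b) = 0\<close>, by the Jacobian criterion.\<close>

definition smooth_cubics :: "cubic_space set" where
  "smooth_cubics = {b. \<forall>x :: complex ^ 3. x \<noteq> 0 \<and> ceval (cubic_form b) (($) x) = 0 \<longrightarrow>
      (\<exists>i. ceval (cpderiv i (cubic_form b)) (($) x) \<noteq> 0)}"


section \<open>The action of \<open>SL\<^sub>3\<close> and of its Lie algebra\<close>

definition SL3 :: "(complex ^ 3 ^ 3) set" where
  "SL3 = {g. det g = 1}"

text \<open>\<open>(g \<cdot> f)(x) = f(g\<^sup>-\<^sup>1 x)\<close>\<close>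

definition SL3_act :: "complex ^ 3 ^ 3 \<Rightarrow> cubic_space \<Rightarrow> cubic_space" where
  "SL3_act g b = cubic_coeffs
      (csubst (cubic_form b) (\<lambda>i. \<Sum>j\<in>UNIV. cconst (matrix_inv g $ i $ j) * cvar j))"

definition SL3_orbit :: "cubic_space \<Rightarrow> cubic_space set" where
  "SL3_orbit b = (\<lambda>g. SL3_act g b) ` SL3"

definition SL3_stabilizer :: "cubic_space \<Rightarrow> (complex ^ 3 ^ 3) set" where
  "SL3_stabilizer b = {g \<in> SL3. SL3_act g b = b}"

text \<open>Stability: closed orbit and finite stabilizer. An orbit of an algebraic group action over
  the complex numbers is Zariski closed iff it is closed in the Euclidean topology used here.\<close>

definition git_stable :: "cubic_space \<Rightarrow> bool" where
  "git_stable b \<longleftrightarrow> closed (SL3_orbit b) \<and> finite (SL3_stabilizer b)"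

definition sl3 :: "(complex ^ 3 ^ 3) set" where
  "sl3 = {\<xi>. trace \<xi> = 0}"

text \<open>The derivative at \<open>t = 0\<close> of \<open>exp(t\<xi>) \<cdot> f = f(exp(-t\<xi>) x)\<close>, which is
  \<open>-\<Sum>\<^sub>i\<^sub>j \<xi>\<^sub>i\<^sub>j x\<^sub>j \<partial>f/\<partial>x\<^sub>i\<close>. As a function of \<open>b\<close> this is the vector field
  on \<open>V\<^sup>\<or>\<close> given by \<open>\<xi>\<close>.\<close>

definition sl3_act :: "complex ^ 3 ^ 3 \<Rightarrow> cubic_space \<Rightarrow> cubic_space" where
  "sl3_act \<xi> b = cubic_coeffs
      (- (\<Sum>i\<in>UNIV. \<Sum>j\<in>UNIV. cconst (\<xi> $ i $ j) * cvar j * cpderiv i (cubic_form b)))"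


section \<open>Differential operators on the space of cubics\<close>

definition holo_on :: "(complex ^ 'n \<Rightarrow> complex) \<Rightarrow> (complex ^ 'n) set \<Rightarrow> bool" where
  "holo_on s U \<longleftrightarrow> (\<forall>a\<in>U. \<exists>D. (s has_derivative D) (at a) \<and> (\<forall>c v. D (c *s v) = c * D v))"

definition pd :: "'n \<Rightarrow> (complex ^ 'n \<Rightarrow> complex) \<Rightarrow> complex ^ 'n \<Rightarrow> complex" where
  "pd I s a = deriv (\<lambda>t. s (a + axis I t)) 0"

text \<open>The operator \<open>\<Prod>\<^sub>I (\<partial>/\<partial>a\<^sub>I)\<^bsup>m\<^sub>I\<^esup>\<close>. The order in which the partial derivatives are taken
  (here that of the exponent vectors) is immaterial for holomorphic functions.\<close>

definition pd_mon :: "(cubic_idx \<Rightarrow>\<^sub>0 nat) \<Rightarrow> (cubic_space \<Rightarrow> complex) \<Rightarrow> cubic_space \<Rightarrow> complex" where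
  "pd_mon m s = foldr (\<lambda>I. pd I ^^ Poly_Mapping.lookup m I) (sorted_key_list_of_set expo UNIV) s"

definition pd_poly :: "cubic_idx cpoly \<Rightarrow> (cubic_space \<Rightarrow> complex) \<Rightarrow> cubic_space \<Rightarrow> complex" where
  "pd_poly P s a = (\<Sum>m\<in>Poly_Mapping.keys P. Poly_Mapping.lookup P m * pd_mon m s a)"

definition const_op :: "cubic_space \<Rightarrow> (cubic_space \<Rightarrow> complex) \<Rightarrow> cubic_space \<Rightarrow> complex" where
  "const_op lam s a = (\<Sum>I\<in>UNIV. lam $ I * pd I s a)"


section \<open>The tautological system\<close>

definition sol :: "cubic_space set \<Rightarrow> (cubic_space \<Rightarrow> complex) set" where
  "sol U = {s. holo_on s U \<and>
      (\<forall>P. csubst P xmon = 0 \<longrightarrow> (\<forall>a\<in>U. pd_poly P s a = 0)) \<and>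
      (\<forall>\<xi>\<in>sl3. \<forall>a\<in>U. (\<Sum>I\<in>UNIV. sl3_act \<xi> a $ I * pd I s a) = 0) \<and>
      (\<forall>a\<in>U. (\<Sum>I\<in>UNIV. a $ I * pd I s a) + s a = 0)}"

text \<open>Representatives of the germs in the stalk at \<open>b\<close>.\<close>

definition sol_stalk :: "cubic_space \<Rightarrow> (cubic_space \<Rightarrow> complex) set" where
  "sol_stalk b = (\<Union>U\<in>{U. open U \<and> b \<in> U}. sol U)"

definition diff_zeros ::
    "((cubic_space \<Rightarrow> complex) \<Rightarrow> cubic_space \<Rightarrow> complex) \<Rightarrow> cubic_space set" where
  "diff_zeros \<delta> = {b \<in> smooth_cubics. \<forall>s\<in>sol_stalk b. \<delta> s b = 0}"

end

theory Submission
  imports Defs "HOL-Computational_Algebra.Fundamental_Theorem_Algebra"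
begin

text \<open>
  By the \<open>sl\<^sub>3\<close>-equations of the tautological system, \<open>\<delta>\<close> kills all solutions at \<open>b\<close> as soon as the
  cubic \<open>h\<close> of \<open>\<delta>\<close> lies in the tangent space \<open>sl\<^sub>3 \<cdot> f(b)\<close> of the orbit. So it suffices to move \<open>h\<close>
  into the tangent space of a suitable cubic in the orbit of the given smooth cubic.

  A smooth cubic has a flex, namely a common zero with its Hessian, hence a Weierstrass form, hence
  (through three collinear flexes) a Hesse form \<open>a x\<^sup>3 + b y\<^sup>3 + c z\<^sup>3 + d x y z\<close>. The tangent space of
  the orbit at the latter consists of the cubics whose coefficient at \<open>x y z\<close> vanishes and whose
  coefficients \<open>p, q, r\<close> at \<open>x\<^sup>3, y\<^sup>3, z\<^sup>3\<close> satisfy \<open>p/a + q/b + r/c = 0\<close>. If \<open>h(u) \<noteq> 0\<close>, then a basis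
  \<open>u, v, w\<close> orthogonal for the polar quadratic form of \<open>h\<close> at \<open>u\<close> kills the coefficient at \<open>x y z\<close>; replacing
  \<open>v\<close> by \<open>v + s u\<close> makes \<open>h(v) \<noteq> 0\<close>, and scaling \<open>u\<close> and \<open>v\<close> gives the other equation.
\<close>

section \<open>Two plane cubics have a common point\<close>

text \<open>Vieta's formulas for \<open>z^3 + p*z^2 + q*z + r\<close>: the fundamental theorem of
  algebra is applied twice to split off a root, and the factor that remains is linear.\<close>

lemma cubic_splits:
  fixes p q r :: complex
  obtains z1 z2 z3 where "p = - (z1 + z2 + z3)" "q = z1 * z2 + z1 * z3 + z2 * z3" "r = - (z1 * z2 * z3)"
proof -
  have "\<not> constant (poly [:r, q, p, 1:])"
    by (simp add: constant_degree)
  then obtain z1 where "poly [:r, q, p, 1:] z1 = 0"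
    using fundamental_theorem_of_algebra by blast
  then have r: "r = - (z1 * (q + z1 * (p + z1)))"
    by (simp add: eq_neg_iff_add_eq_0)
  have "\<not> constant (poly [:q + z1 * (p + z1), p + z1, 1:])"
    by (simp add: constant_degree)
  then obtain z2 where "poly [:q + z1 * (p + z1), p + z1, 1:] z2 = 0"
    using fundamental_theorem_of_algebra by blast
  then have q: "q = - z1 * (p + z1) - z2 * (p + z1 + z2)"
    by (simp add: algebra_simps) (metis add.commute add.left_commute add_eq_0_iff)
  show thesis
    by (rule that[of z1 z2 "- (p + z1 + z2)"]) (simp_all add: r q algebra_simps)
qed

text \<open>The norm of \<open>a + b z + c z\<^sup>2\<close> from \<open>\<complex>[z] / (z\<^sup>3 + p z\<^sup>2 + q z + r)\<close> to \<open>\<complex>\<close>, that is, the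
  resultant of the two polynomials.\<close>

definition cubic_norm :: "complex \<Rightarrow> complex \<Rightarrow> complex \<Rightarrow> complex \<Rightarrow> complex \<Rightarrow> complex \<Rightarrow> complex" where
  "cubic_norm p q r a b c =
     a^3 - a^2*b*p + a^2*c*(p^2 - 2*q) + a*b^2*q + a*b*c*(3*r - p*q) + a*c^2*(q^2 - 2*p*r)
     - b^3*r + b^2*c*p*r - b*c^2*q*r + c^3*r^2"

text \<open>Once the monic cubic is split, the norm is the product of the values of
  \<open>a + b*z + c*z^2\<close> at its three roots, so one of these values is zero.\<close>

lemma cubic_norm_zero_imp_common_root:
  assumes "cubic_norm p q r a b c = 0"
  shows "\<exists>z. z^3 + p*z^2 + q*z + r = 0 \<and> a + b*z + c*z^2 = 0"
proof -
  obtain z1 z2 z3 where z: "p = - (z1 + z2 + z3)" "q = z1 * z2 + z1 * z3 + z2 * z3" "r = - (z1 * z2 * z3)"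
    by (rule cubic_splits)
  have "cubic_norm p q r a b c = (a + b*z1 + c*z1^2) * (a + b*z2 + c*z2^2) * (a + b*z3 + c*z3^2)"
    unfolding cubic_norm_def z by (simp add: algebra_simps eval_nat_numeral)
  then consider "a + b*z1 + c*z1^2 = 0" | "a + b*z2 + c*z2^2 = 0" | "a + b*z3 + c*z3^2 = 0"
    using assms by auto
  moreover have "z^3 + p*z^2 + q*z + r = (z - z1) * (z - z2) * (z - z3)" for z
    unfolding z by (simp add: algebra_simps eval_nat_numeral)
  ultimately show ?thesis
    by cases (metis diff_self mult_zero_left mult_zero_right)+
qed

text \<open>Weighted homogeneity: if the six arguments are binary forms of degrees 1, 2, 3, 3, 2, 1,
  then the norm is a form of degree 9, the Bezout number of two cubics.\<close>

lemma cubic_norm_scale: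
  "cubic_norm (t*p) (t^2*q) (t^3*r) (t^3*a) (t^2*b) (t*c) = t^9 * cubic_norm p q r a b c"
  unfolding cubic_norm_def by (simp add: algebra_simps eval_nat_numeral)

text \<open>Eliminating \<open>z\<close> leaves the resultant \<open>n\<close>, a binary form of
  degree 9; such a form has a nontrivial zero \<open>(x, y)\<close>, over which the two polynomials
  in \<open>z\<close> share a root.\<close>

lemma monic_cubic_common_zero:
  fixes p0 p1 q0 q1 q2 r0 r1 r2 r3 a0 a1 a2 a3 b0 b1 b2 c0 c1 :: complex
  defines "p \<equiv> \<lambda>x y. p0*x + p1*y"
    and "q \<equiv> \<lambda>x y. q0*x^2 + q1*x*y + q2*y^2"
    and "r \<equiv> \<lambda>x y. r0*x^3 + r1*x^2*y + r2*x*y^2 + r3*y^3"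
    and "a \<equiv> \<lambda>x y. a0*x^3 + a1*x^2*y + a2*x*y^2 + a3*y^3"
    and "b \<equiv> \<lambda>x y. b0*x^2 + b1*x*y + b2*y^2"
    and "c \<equiv> \<lambda>x y. c0*x + c1*y"
  shows "\<exists>x y z. \<not> (x = 0 \<and> y = 0) \<and> z^3 + p x y*z^2 + q x y*z + r x y = 0
           \<and> a x y + b x y*z + c x y*z^2 = 0"
proof -
  define n where "n x y = cubic_norm (p x y) (q x y) (r x y) (a x y) (b x y) (c x y)" for x y
  have "\<exists>x y. \<not> (x = 0 \<and> y = 0) \<and> n x y = 0"
  proof (rule ccontr)
    assume nz: "\<not> ?thesis"
    \<comment> \<open>The dehomogenization \<open>n 1 y\<close> as a polynomial in \<open>y\<close>.
      Having no root, it must be constant.\<close>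
    define P where "P = (let p = [:p0, p1:]; q = [:q0, q1, q2:]; r = [:r0, r1, r2, r3:];
        a = [:a0, a1, a2, a3:]; b = [:b0, b1, b2:]; c = [:c0, c1:] in
        a^3 - a^2*b*p + a^2*c*(p^2 - 2*q) + a*b^2*q + a*b*c*(3*r - p*q) + a*c^2*(q^2 - 2*p*r)
        - b^3*r + b^2*c*p*r - b*c^2*q*r + c^3*r^2)"
    have P: "poly P y = n 1 y" for y
    proof -
      have "poly [:p0, p1:] y = p 1 y" "poly [:q0, q1, q2:] y = q 1 y"
        "poly [:r0, r1, r2, r3:] y = r 1 y" "poly [:a0, a1, a2, a3:] y = a 1 y"
        "poly [:b0, b1, b2:] y = b 1 y" "poly [:c0, c1:] y = c 1 y"
        unfolding p_def q_def r_def a_def b_def c_def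
        by (simp_all add: algebra_simps power2_eq_square power3_eq_cube)
      then show ?thesis
        unfolding P_def n_def cubic_norm_def Let_def
        by (simp only: poly_add poly_diff poly_mult poly_power poly_numeral)
    qed
    have "constant (poly P)"
      using fundamental_theorem_of_algebra[of P] nz P by (metis zero_neq_one)
    then obtain k where k: "n 1 y = k" for y
      unfolding constant_def P[symmetric] by metis
    have hom: "n (t*x) (t*y) = t^9 * n x y" for t x y
    proof -
      have "p (t*x) (t*y) = t * p x y" "q (t*x) (t*y) = t^2 * q x y" "r (t*x) (t*y) = t^3 * r x y"
        "a (t*x) (t*y) = t^3 * a x y" "b (t*x) (t*y) = t^2 * b x y" "c (t*x) (t*y) = t * c x y"
        unfolding p_def q_def r_def a_def b_def c_def by (simp_all add: algebra_simps eval_nat_numeral)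
      then show ?thesis
        by (simp add: n_def cubic_norm_scale)
    qed
    \<comment> \<open>So \<open>n\<close> agrees with \<open>k * x^9\<close> away from
      \<open>x = 0\<close>. Continuity extends this to the point \<open>(0, 1)\<close>, which is
      then a zero after all.\<close>
    have "n t 1 = t^9 * k" if "t \<noteq> 0" for t
      using hom[of t 1 "1/t"] that k by simp
    then have "((\<lambda>t. t^9 * k) \<longlongrightarrow> n 0 1) (at 0) \<longleftrightarrow> ((\<lambda>t. n t 1) \<longlongrightarrow> n 0 1) (at 0)"
      by (intro Lim_cong_within) auto
    moreover have "isCont (\<lambda>t. n t 1) 0"
      unfolding n_def cubic_norm_def p_def q_def r_def a_def b_def c_def
      by (intro continuous_intros)
    moreover have "((\<lambda>t. t^9 * k) \<longlongrightarrow> 0^9 * k) (at (0::complex))"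
      by (intro tendsto_intros)
    ultimately have "n 0 1 = 0^9 * k"
      using tendsto_unique[OF at_neq_bot] unfolding isCont_def by blast
    then show False
      using nz by (metis mult_zero_left power_zero_numeral zero_neq_one)
  qed
  then show ?thesis
    unfolding n_def using cubic_norm_zero_imp_common_root by metis
qed

section \<open>Cubics as diagonals of trilinear forms\<close>

locale trilinear =
  fixes F :: "complex^3 \<Rightarrow> complex^3 \<Rightarrow> complex^3 \<Rightarrow> complex"
  assumes add1: "F (u + u') v w = F u v w + F u' v w"
    and add2: "F u (v + v') w = F u v w + F u v' w"
    and add3: "F u v (w + w') = F u v w + F u v w'"
    and scale1: "F (k *s u) v w = k * F u v w"
    and scale2: "F u (k *s v) w = k * F u v w"
    and scale3: "F u v (k *s w) = k * F u v w"
begin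

lemmas expand = add1 add2 add3 scale1 scale2 scale3

lemma zero [simp]: "F 0 v w = 0" "F u 0 w = 0" "F u v 0 = 0"
  using scale1[of 0 0] scale2[of _ 0 0] scale3[of _ _ 0 0] by simp_all

lemma diag_expand:
  "F (x *s u + y *s v + z *s w) (x *s u + y *s v + z *s w) (x *s u + y *s v + z *s w) =
     x^3 * F u u u + x^2*y * (F u u v + F u v u + F v u u) + x*y^2 * (F u v v + F v u v + F v v u)
     + y^3 * F v v v + x^2*z * (F u u w + F u w u + F w u u)
     + x*y*z * (F u v w + F u w v + F v u w + F v w u + F w u v + F w v u)
     + y^2*z * (F v v w + F v w v + F w v v) + x*z^2 * (F u w w + F w u w + F w w u)
     + y*z^2 * (F v w w + F w v w + F w w v) + z^3 * F w w w"
  by (simp add: expand distrib_left power2_eq_square power3_eq_cube mult.assoc mult.left_commute)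

end

lemma vec3_expand: "(v :: complex^3) = v $ 1 *s axis 1 1 + v $ 2 *s axis 2 1 + v $ 3 *s axis 3 1"
  by (simp add: vec_eq_iff forall_3 axis_def)

lemma trilinear_common_zero_monic:
  assumes "trilinear F" "trilinear G" and nz: "F (axis 3 1) (axis 3 1) (axis 3 1) \<noteq> 0"
  shows "\<exists>p. p \<noteq> 0 \<and> F p p p = 0 \<and> G p p p = 0"
proof -
  interpret F: trilinear F by fact
  interpret G: trilinear G by fact
  let ?e = "\<lambda>i. axis i 1 :: complex^3"
  define d where "d = F (?e 3) (?e 3) (?e 3)"
  define d' where "d' = G (?e 3) (?e 3) (?e 3)"
  define f where "f i j k = F (?e i) (?e j) (?e k) / d" for i j k
  \<comment> \<open>\<open>F\<close> is made monic in \<open>z\<close> by dividing by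
    \<open>d\<close>; subtracting \<open>d'\<close> times the result from \<open>G\<close> removes
    its \<open>z^3\<close> term, as the elimination lemma requires.\<close>
  define g where "g i j k = G (?e i) (?e j) (?e k) - d' * f i j k" for i j k
  have f: "F (?e i) (?e j) (?e k) = d * f i j k" for i j k
    using nz by (simp add: f_def d_def)
  have g: "G (?e i) (?e j) (?e k) = g i j k + d' * f i j k" for i j k
    by (simp add: g_def)
  have fg3: "f 3 3 3 = 1" "g 3 3 3 = 0"
    using nz by (simp_all add: f_def g_def d_def d'_def)
  obtain x y z where xyz: "\<not> (x = 0 \<and> y = 0)"
    "z^3 + ((f 1 3 3 + f 3 1 3 + f 3 3 1)*x + (f 2 3 3 + f 3 2 3 + f 3 3 2)*y)*z^2
      + ((f 1 1 3 + f 1 3 1 + f 3 1 1)*x^2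
         + (f 1 2 3 + f 1 3 2 + f 2 1 3 + f 2 3 1 + f 3 1 2 + f 3 2 1)*x*y
         + (f 2 2 3 + f 2 3 2 + f 3 2 2)*y^2)*z
      + (f 1 1 1*x^3 + (f 1 1 2 + f 1 2 1 + f 2 1 1)*x^2*y + (f 1 2 2 + f 2 1 2 + f 2 2 1)*x*y^2
         + f 2 2 2*y^3) = 0"
    "(g 1 1 1*x^3 + (g 1 1 2 + g 1 2 1 + g 2 1 1)*x^2*y + (g 1 2 2 + g 2 1 2 + g 2 2 1)*x*y^2
         + g 2 2 2*y^3)
      + ((g 1 1 3 + g 1 3 1 + g 3 1 1)*x^2
         + (g 1 2 3 + g 1 3 2 + g 2 1 3 + g 2 3 1 + g 3 1 2 + g 3 2 1)*x*y
         + (g 2 2 3 + g 2 3 2 + g 3 2 2)*y^2)*z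
      + ((g 1 3 3 + g 3 1 3 + g 3 3 1)*x + (g 2 3 3 + g 3 2 3 + g 3 3 2)*y)*z^2 = 0"
    using monic_cubic_common_zero[of
      "f 1 3 3 + f 3 1 3 + f 3 3 1"
      "f 2 3 3 + f 3 2 3 + f 3 3 2"
      "f 1 1 3 + f 1 3 1 + f 3 1 1"
      "f 1 2 3 + f 1 3 2 + f 2 1 3 + f 2 3 1 + f 3 1 2 + f 3 2 1"
      "f 2 2 3 + f 2 3 2 + f 3 2 2"
      "f 1 1 1"
      "f 1 1 2 + f 1 2 1 + f 2 1 1"
      "f 1 2 2 + f 2 1 2 + f 2 2 1"
      "f 2 2 2"
      "g 1 1 1"
      "g 1 1 2 + g 1 2 1 + g 2 1 1"
      "g 1 2 2 + g 2 1 2 + g 2 2 1"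
      "g 2 2 2"
      "g 1 1 3 + g 1 3 1 + g 3 1 1"
      "g 1 2 3 + g 1 3 2 + g 2 1 3 + g 2 3 1 + g 3 1 2 + g 3 2 1"
      "g 2 2 3 + g 2 3 2 + g 3 2 2"
      "g 1 3 3 + g 3 1 3 + g 3 3 1"
      "g 2 3 3 + g 3 2 3 + g 3 3 2"]
    by (elim exE conjE) (rule that)
  define p where "p = x *s ?e 1 + y *s ?e 2 + z *s ?e 3"
  have "p $ 1 = x" "p $ 2 = y"
    by (simp_all add: p_def axis_def)
  then have "p \<noteq> 0"
    using xyz(1) by auto
  \<comment> \<open>The value at \<open>(x, y, z)\<close> of the cubic whose polarization has
    coefficients \<open>h\<close>, linear in \<open>h\<close>.\<close>
  define S :: "(3 \<Rightarrow> 3 \<Rightarrow> 3 \<Rightarrow> complex) \<Rightarrow> complex" where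
    "S h = h 1 1 1*x^3 + (h 1 1 2 + h 1 2 1 + h 2 1 1)*x^2*y + (h 1 2 2 + h 2 1 2 + h 2 2 1)*x*y^2
         + h 2 2 2*y^3 + (h 1 1 3 + h 1 3 1 + h 3 1 1)*x^2*z
         + (h 1 2 3 + h 1 3 2 + h 2 1 3 + h 2 3 1 + h 3 1 2 + h 3 2 1)*x*y*z
         + (h 2 2 3 + h 2 3 2 + h 3 2 2)*y^2*z
      + (h 1 3 3 + h 3 1 3 + h 3 3 1)*x*z^2 + (h 2 3 3 + h 3 2 3 + h 3 3 2)*y*z^2 + h 3 3 3*z^3" for h
  have Sf: "S f = 0" and Sg: "S g = 0"
    using xyz(2,3) by (simp_all add: S_def fg3 algebra_simps)
  have "F p p p = S (\<lambda>i j k. F (?e i) (?e j) (?e k))"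
    unfolding p_def S_def F.diag_expand by (simp add: ac_simps)
  also have "\<dots> = d * S f"
    unfolding f by (simp add: S_def algebra_simps)
  finally have 1: "F p p p = 0"
    by (simp add: Sf)
  have "G p p p = S (\<lambda>i j k. G (?e i) (?e j) (?e k))"
    unfolding p_def S_def G.diag_expand by (simp add: ac_simps)
  also have "\<dots> = S g + d' * S f"
    unfolding g by (simp add: S_def algebra_simps)
  finally have "G p p p = 0"
    by (simp add: Sf Sg)
  with 1 \<open>p \<noteq> 0\<close> show ?thesis by blast
qed

text \<open>Unless \<open>axis 3 1\<close> is itself a common zero, one of the two forms has a
  nonzero \<open>z^3\<close> coefficient and can play the monic role.\<close>

theorem trilinear_common_zero:
  assumes "trilinear F" "trilinear G"
  shows "\<exists>p. p \<noteq> 0 \<and> F p p p = 0 \<and> G p p p = 0"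
proof (cases "F (axis 3 1) (axis 3 1) (axis 3 1) = 0 \<and> G (axis 3 1) (axis 3 1) (axis 3 1) = 0")
  case True
  then show ?thesis
    by (intro exI[of _ "axis 3 1"]) (simp add: axis_eq_0_iff)
next
  case False
  then show ?thesis
    using trilinear_common_zero_monic[OF assms] trilinear_common_zero_monic[OF assms(2,1)] by metis
qed

section \<open>Hesse normal form of a smooth cubic\<close>

locale sym_trilinear = trilinear +
  assumes swap12: "F u v w = F v u w" and swap23: "F u v w = F u w v"
begin

lemma swaps:
  "F u w v = F u v w" "F v u w = F u v w" "F v w u = F u v w" "F w u v = F u v w" "F w v u = F u v w"
  by (metis swap12 swap23)+

lemma sym_diag_expand:
  "F (x *s u + y *s v + z *s w) (x *s u + y *s v + z *s w) (x *s u + y *s v + z *s w) =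
     x^3 * F u u u + 3*x^2*y * F u u v + 3*x*y^2 * F u v v + y^3 * F v v v + 3*x^2*z * F u u w
     + 6*x*y*z * F u v w + 3*y^2*z * F v v w + 3*x*z^2 * F u w w + 3*y*z^2 * F v w w + z^3 * F w w w"
proof -
  have "F u v u = F u u v" "F v u u = F u u v" "F v u v = F u v v" "F v v u = F u v v"
    "F u w u = F u u w" "F w u u = F u u w" "F w u w = F u w w" "F w w u = F u w w"
    "F v w v = F v v w" "F w v v = F v v w" "F w v w = F v w w" "F w w v = F v w w"
    "F u w v = F u v w" "F v u w = F u v w" "F v w u = F u v w" "F w u v = F u v w" "F w v u = F u v w"
    by (rule swaps)+
  then show ?thesis
    unfolding diag_expand by (simp add: algebra_simps)
qed

text \<open>Recovers the gradient from values on the diagonal, so that later computations can use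
  explicit cubic polynomials.\<close>

lemma polarization:
  "6 * F x x y = F (x + y) (x + y) (x + y) - F (x - y) (x - y) (x - y) - 2 * F y y y"
proof -
  have *: "x - y = x + (-1) *s y"
    by (simp add: vec_eq_iff)
  have "F y x x = F x x y" "F x y x = F x x y" "F y x y = F x y y" "F y y x = F x y y"
    by (rule swaps)+
  then show ?thesis
    unfolding * by (simp only: expand) (simp add: algebra_simps)
qed

lemma compose: "sym_trilinear (\<lambda>u v w. F (M *v u) (M *v v) (M *v w))"
  by unfold_locales
    (simp_all add: matrix_vector_right_distrib vector_scalar_commute expand,
     (rule swap12 swap23)+)

end

text \<open>The form \<open>x \<mapsto> F x x x\<close> has gradient \<open>v \<mapsto> 3 F x x v\<close> at \<open>x\<close>.\<close>

definition nonsingular :: "(complex^3 \<Rightarrow> complex^3 \<Rightarrow> complex^3 \<Rightarrow> complex) \<Rightarrow> bool" where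
  "nonsingular F \<longleftrightarrow> (\<forall>x. x \<noteq> 0 \<longrightarrow> (\<exists>v. F x x v \<noteq> 0))"

section \<open>Kernels, images and bases\<close>

lemma det_zero_imp_ker:
  fixes A :: "complex^'n^'n"
  assumes "det A = 0"
  obtains x where "x \<noteq> 0" "A *v x = 0"
  using assms invertible_det_nz[of A] invertible_left_inverse[of A] matrix_left_invertible_ker[of A]
  by metis

lemma det_nz_imp_inj:
  fixes A :: "complex^'n^'n"
  assumes "det A \<noteq> 0" "A *v x = 0"
  shows "x = 0"
  using assms invertible_det_nz[of A] invertible_left_inverse[of A] matrix_left_invertible_ker[of A]
  by metis

lemma det_nz_imp_surj:
  fixes A :: "complex^'n^'n"
  assumes "det A \<noteq> 0"
  obtains x where "y = A *v x"
  using assms invertible_det_nz[of A] invertible_right_inverse[of A]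
    matrix_right_invertible_surjective[of A] by (metis surjD)

lemma nonsingular_compose:
  assumes "nonsingular F" "det M \<noteq> 0"
  shows "nonsingular (\<lambda>u v w. F (M *v u) (M *v v) (M *v w))"
  unfolding nonsingular_def
proof (intro allI impI)
  fix x :: "complex^3"
  assume "x \<noteq> 0"
  then have "M *v x \<noteq> 0"
    using det_nz_imp_inj[OF assms(2)] by auto
  then obtain v where "F (M *v x) (M *v x) v \<noteq> 0"
    using assms(1) unfolding nonsingular_def by blast
  then show "\<exists>v. F (M *v x) (M *v x) (M *v v) \<noteq> 0"
    using det_nz_imp_surj[OF assms(2), of v] by metis
qed

definition cols3 :: "complex^3 \<Rightarrow> complex^3 \<Rightarrow> complex^3 \<Rightarrow> complex^3^3" where
  "cols3 u v w = (\<chi> i. vector [u $ i, v $ i, w $ i])"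

lemma cols3_mult: "cols3 u v w *v x = x $ 1 *s u + x $ 2 *s v + x $ 3 *s w"
  by (simp add: cols3_def vec_eq_iff matrix_vector_mult_def sum_3 mult.commute)

lemma det_cols3:
  "det (cols3 u v w) = u$1 * (v$2 * w$3 - v$3 * w$2) - u$2 * (v$1 * w$3 - v$3 * w$1)
     + u$3 * (v$1 * w$2 - v$2 * w$1)"
  by (simp add: cols3_def det_3 algebra_simps)

text \<open>If all these determinants vanish, taking the axis vectors for \<open>r\<close> shows
  that the cross product of \<open>n\<close> and \<open>p\<close> is zero, hence \<open>n\<close> is
  a multiple of \<open>p\<close>.\<close>

lemma extend_to_cols3:
  assumes "p \<noteq> 0" and indep: "\<And>k. n \<noteq> k *s p"
  obtains r where "det (cols3 n p r) \<noteq> 0"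
proof (rule ccontr)
  assume "\<not> thesis"
  then have *: "det (cols3 n p r) = 0" for r
    using that by blast
  have m: "n$1 * p$2 = n$2 * p$1" "n$1 * p$3 = n$3 * p$1" "n$2 * p$3 = n$3 * p$2"
    using *[of "axis 1 1"] *[of "axis 2 1"] *[of "axis 3 1"]
    by (simp_all add: det_cols3 axis_def algebra_simps)
  consider "p$1 \<noteq> 0" | "p$2 \<noteq> 0" | "p$3 \<noteq> 0"
    using \<open>p \<noteq> 0\<close> by (auto simp: vec_eq_iff forall_3)
  then show False
  proof cases
    case 1
    then have "n = (n$1 / p$1) *s p"
      using m by (simp add: vec_eq_iff forall_3 field_simps)
    then show False using indep by blast
  next
    case 2
    then have "n = (n$2 / p$2) *s p"
      using m by (simp add: vec_eq_iff forall_3 field_simps)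
    then show False using indep by blast
  next
    case 3
    then have "n = (n$3 / p$3) *s p"
      using m by (simp add: vec_eq_iff forall_3 field_simps)
    then show False using indep by blast
  qed
qed

context sym_trilinear
begin

text \<open>\<open>p\<close> is a common zero of the form and of its Hessian determinant; \<open>n\<close> spans, together with
  \<open>p\<close>, the tangent line at \<open>p\<close>, on which the form is then a cube.\<close>

lemma flex:
  assumes "nonsingular F"
  obtains p n r where "F p p p = 0" "\<And>w. F p n w = 0" "det (cols3 n p r) \<noteq> 0"
proof -
  let ?e = "\<lambda>i. axis i 1 :: complex^3"
  \<comment> \<open>Each row has its own argument, which makes the determinant trilinear though not
    symmetric. On the diagonal it is the Hessian determinant up to a constant factor.\<close>
  define A where "A p q r = (vector
    [vector [F p (?e 1) (?e 1), F p (?e 1) (?e 2), F p (?e 1) (?e 3)],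
     vector [F q (?e 2) (?e 1), F q (?e 2) (?e 2), F q (?e 2) (?e 3)],
     vector [F r (?e 3) (?e 1), F r (?e 3) (?e 2), F r (?e 3) (?e 3)]] :: complex^3^3)" for p q r
  have "trilinear (\<lambda>p q r. det (A p q r))"
    by unfold_locales (simp_all add: A_def det_3 add1 scale1 algebra_simps)
  then obtain p where p: "p \<noteq> 0" "F p p p = 0" "det (A p p p) = 0"
    using trilinear_common_zero[of F "\<lambda>p q r. det (A p q r)"] trilinear_axioms by blast
  from p(3) obtain n where n: "n \<noteq> 0" "A p p p *v n = 0"
    by (rule det_zero_imp_ker)
  have "F p n (axis i 1) = 0" for i
  proof -
    have "F p (axis i 1) n = F p (axis i 1) (n $ 1 *s axis 1 1 + n $ 2 *s axis 2 1 + n $ 3 *s axis 3 1)"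
      by (simp flip: vec3_expand)
    also have "\<dots> = 0"
      using n(2) exhaust_3[of i]
      by (auto simp: A_def expand vec_eq_iff forall_3 matrix_vector_mult_def sum_3 mult.commute)
    finally show ?thesis
      using swap23 by metis
  qed
  then have pn: "F p n w = 0" for w
    by (subst vec3_expand[of w]) (simp add: expand)
  \<comment> \<open>Otherwise the gradient at \<open>p\<close> would vanish.\<close>
  have "n \<noteq> k *s p" for k
  proof
    assume k: "n = k *s p"
    then have "k \<noteq> 0"
      using n(1) by auto
    then have "F p p w = 0" for w
      using pn[of w] by (simp add: k scale2)
    then show False
      using assms p(1) unfolding nonsingular_def by blast
  qed
  then obtain r where "det (cols3 n p r) \<noteq> 0"
    using extend_to_cols3 p(1) by blast
  with that p(2) pn show thesis by blast
qed

end

section \<open>Weierstrass form\<close>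

lemma complex_root_exists:
  fixes c :: complex
  assumes "n > 0"
  obtains z where "z ^ n = c"
proof -
  have "\<not> constant (poly (monom 1 n + [:- c:]))"
  proof -
    have "degree (monom 1 n + [:- c:]) = n"
      using assms degree_add_eq_left[of "[:- c:]" "monom 1 n"] by (simp add: degree_monom_eq)
    then show ?thesis
      using assms by (simp add: constant_degree)
  qed
  then obtain z where "poly (monom 1 n + [:- c:]) z = 0"
    using fundamental_theorem_of_algebra by blast
  then show thesis
    by (intro that[of z]) (simp add: poly_monom)
qed

text \<open>The usual equation up to the sign of \<open>y^2 z\<close>. The flex is
  \<open>(0, 1, 0)\<close>, with tangent line \<open>z = 0\<close>.\<close>

definition weierstrass :: "complex \<Rightarrow> complex \<Rightarrow> complex^3 \<Rightarrow> complex" where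
  "weierstrass b c v = (v$1)^3 + (v$2)^2 * v$3 + b * v$1 * (v$3)^2 + c * (v$3)^3"

context sym_trilinear
begin

text \<open>In the basis \<open>n\<close>, \<open>p\<close>, \<open>r\<close> the flex conditions
  kill the terms \<open>y^3\<close>, \<open>x y^2\<close>, \<open>x^2 y\<close> and
  \<open>x y z\<close>. Changing \<open>r\<close> removes \<open>y z^2\<close> and
  \<open>x^2 z\<close>, and scaling \<open>n\<close> and \<open>p\<close> normalizes
  \<open>x^3\<close> and \<open>y^2 z\<close>.\<close>

lemma weierstrass_form:
  assumes "nonsingular F"
  obtains M b c where "det M \<noteq> 0" "\<And>v. F (M *v v) (M *v v) (M *v v) = weierstrass b c v"
proof -
  obtain p n r0 where p: "F p p p = 0" "\<And>w. F p n w = 0" "det (cols3 n p r0) \<noteq> 0"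
    using flex[OF assms] by blast
  have sp: "F n p w = 0" "F n n p = 0" "F n p p = 0" "F p p n = 0" for w
    using p(2) swaps by metis+
  have span: "\<exists>x y z. w = x *s n + y *s p + z *s r0" for w
  proof -
    obtain v where "w = cols3 n p r0 *v v"
      using det_nz_imp_surj[OF p(3)] by metis
    then show ?thesis by (auto simp: cols3_mult)
  qed
  have ppr: "F p p r0 \<noteq> 0"
  proof
    assume "F p p r0 = 0"
    then have "F p p w = 0" for w
      using span[of w] by (auto simp: expand p(1) sp)
    moreover have "p \<noteq> 0"
      using p(3) by (auto simp: det_cols3)
    ultimately show False
      using assms unfolding nonsingular_def by blast
  qed
  have nnn: "F n n n \<noteq> 0"
  proof
    assume n: "F n n n = 0"
    \<comment> \<open>If \<open>F n n n = 0\<close>, the line through \<open>n\<close> and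
      \<open>p\<close> lies on the curve; this \<open>x\<close> makes \<open>n + x *s p\<close> a
      singular point on that line.\<close>
    obtain x where x: "x ^ 2 = - F n n r0 / F p p r0"
      using complex_root_exists[of 2] by auto
    have "F (n + x *s p) (n + x *s p) w = 0" for w
    proof -
      have "F (n + x *s p) (n + x *s p) r0 = F n n r0 + x^2 * F p p r0"
        by (simp add: expand sp p(2) power2_eq_square)
      also have "\<dots> = 0"
        using ppr by (simp add: x)
      finally have "F (n + x *s p) (n + x *s p) r0 = 0" .
      moreover have "F (n + x *s p) (n + x *s p) n = 0" "F (n + x *s p) (n + x *s p) p = 0"
        by (simp_all add: expand sp p n)
      ultimately show ?thesis
        using span[of w] by (auto simp: add3 scale3)
    qed
    moreover have "n + x *s p \<noteq> 0"
    proof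
      assume "n + x *s p = 0"
      then have "n = (- x) *s p"
        by (simp add: eq_neg_iff_add_eq_0)
      then show False
        using p(3) by (simp add: det_cols3 algebra_simps)
    qed
    ultimately show False
      using assms unfolding nonsingular_def by blast
  qed
  \<comment> \<open>\<open>s\<close> solves \<open>F p r r = 0\<close> and \<open>t\<close> solves
    \<open>F n n r = 0\<close>.\<close>
  define s where "s = - F p r0 r0 / (2 * F p p r0)"
  define t where "t = - F n n r0 / F n n n"
  define r where "r = r0 + s *s p + t *s n"
  \<comment> \<open>The scalings that give \<open>x^3\<close> and \<open>y^2 z\<close> coefficient
    1; the 3 below is the multiplicity of \<open>F p p r0\<close> in the expansion of the
    diagonal.\<close>
  obtain x where x: "x ^ 3 = 1 / F n n n"
    using complex_root_exists[of 3] by auto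
  obtain y where y: "y ^ 2 = 1 / (3 * F p p r0)"
    using complex_root_exists[of 2] by auto
  have xy: "x \<noteq> 0" "y \<noteq> 0"
    using x y nnn ppr by auto
  define M where "M = cols3 (x *s n) (y *s p) r"
  have "det M = x * y * det (cols3 n p r0)"
    by (simp add: M_def r_def det_cols3 algebra_simps)
  then have "det M \<noteq> 0"
    using xy p(3) by simp
  have prr: "F p r r = 0"
  proof -
    have "F p r0 p = F p p r0"
      by (rule swap23)
    then have "F p r r = F p r0 r0 + 2 * s * F p p r0"
      using swap23[of p r0 n] by (simp add: r_def expand p sp)
    then show ?thesis
      using ppr by (simp add: s_def)
  qed
  have nnr: "F n n r = 0"
    using nnn by (simp add: r_def expand sp) (simp add: t_def)
  have pprr: "F p p r = F p p r0"
    by (simp add: r_def expand sp p)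
  have "F (M *v v) (M *v v) (M *v v) = weierstrass (3 * x * F n r r) (F r r r) v" for v
  proof -
    have xy1: "x^3 * F n n n = 1" "3 * y^2 * F p p r0 = 1"
      using nnn ppr by (simp_all add: x y)
    have "F (M *v v) (M *v v) (M *v v) = (x^3 * F n n n) * (v$1)^3 + (3 * y^2 * F p p r0) * ((v$2)^2 * v$3)
        + 3 * x * F n r r * v$1 * (v$3)^2 + F r r r * (v$3)^3"
      unfolding M_def cols3_mult sym_diag_expand
      by (simp add: expand sp p prr nnr pprr power2_eq_square power3_eq_cube algebra_simps)
    then show ?thesis
      unfolding xy1 weierstrass_def by (simp add: algebra_simps)
  qed
  with that \<open>det M \<noteq> 0\<close> show thesis by blast
qed

end

text \<open>By polarization the expression is \<open>6 * F x x v\<close>; regularity at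
  \<open>x\<close> can thus be tested on the cubic function \<open>f\<close>.\<close>

lemma nonsingularD:
  assumes "sym_trilinear F" "nonsingular F" "\<And>v. F v v v = f v" "x \<noteq> 0"
  shows "\<exists>v. f (x + v) - f (x - v) - 2 * f v \<noteq> 0"
proof -
  interpret sym_trilinear F by fact
  obtain v where "F x x v \<noteq> 0"
    using assms(2,4) unfolding nonsingular_def by blast
  then have "6 * F x x v \<noteq> 0"
    by simp
  then show ?thesis
    unfolding polarization assms(3) by blast
qed

section \<open>From Weierstrass form to Hesse form\<close>

definition hesse :: "complex \<Rightarrow> complex \<Rightarrow> complex \<Rightarrow> complex \<Rightarrow> complex^3 \<Rightarrow> complex" where
  "hesse a b c d v = a * (v$1)^3 + b * (v$2)^3 + c * (v$3)^3 + d * v$1 * v$2 * v$3"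

text \<open>The equations say that the cubic form minus \<open>(x + t z)\<^sup>3\<close> is a product of three lines, namely
  \<open>z (y\<^sup>2 - 3 t (x + r z)\<^sup>2)\<close>: the tangents at the three flexes on the line \<open>x + t z = 0\<close>.\<close>

lemma weierstrass_flex_line:
  assumes "sym_trilinear F" "nonsingular F" "\<And>v. F v v v = weierstrass b c v"
  obtains t r where "t \<noteq> 0" "t \<noteq> r" "b = 3 * t^2 - 6 * t * r" "c = t^3 - 3 * t * r^2"
proof -
  \<comment> \<open>For \<open>b = c = 0\<close> the curve would have a cusp at
    \<open>(0, 0, 1)\<close>.\<close>
  have "axis 3 1 \<noteq> (0 :: complex^3)"
    by (simp add: axis_eq_0_iff)
  then have bc: "\<not> (b = 0 \<and> c = 0)"
    using nonsingularD[OF assms, of "axis 3 1"]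
    by (auto simp: weierstrass_def axis_def algebra_simps power3_eq_cube power2_eq_square)
  \<comment> \<open>The quartic results from eliminating \<open>r\<close> between the two equations
    for \<open>b\<close> and \<open>c\<close>.\<close>
  obtain t where t: "t \<noteq> 0" "b^2 + 12 * c * t - 6 * b * t^2 - 3 * t^4 = 0"
  proof (cases "b = 0")
    case True
    \<comment> \<open>For \<open>b = 0\<close> the quartic is \<open>3*t\<close> times
      \<open>4*c - t^3\<close>; the root 0 has to be avoided.\<close>
    obtain t where t: "t^3 = 4 * c"
      using complex_root_exists[of 3] by auto
    then have "t \<noteq> 0"
      using True bc by auto
    with t True that[of t] show thesis
      by (auto simp: eval_nat_numeral algebra_simps)
  next
    case False
    have "\<not> constant (poly [:b^2, 12 * c, - 6 * b, 0, -3:])"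
      by (simp add: constant_degree)
    then obtain t where t: "poly [:b^2, 12 * c, - 6 * b, 0, -3:] t = 0"
      using fundamental_theorem_of_algebra by blast
    then have "t \<noteq> 0"
      using False by auto
    with t that[of t] show thesis
      by (auto simp: eval_nat_numeral algebra_simps)
  qed
  define r where "r = (3 * t^2 - b) / (6 * t)"
  have b: "b = 3 * t^2 - 6 * t * r"
    using t(1) by (simp add: r_def)
  have "12 * t * (c - t^3 + 3 * t * r^2) = b^2 + 12 * c * t - 6 * b * t^2 - 3 * t^4"
    unfolding b by (simp add: eval_nat_numeral algebra_simps)
  then have "c - t^3 + 3 * t * r^2 = 0"
    using t by simp
  then have c: "c = t^3 - 3 * t * r^2"
    by algebra
  have "t \<noteq> r"
  proof
    assume "t = r"
    then have bc: "b = - 3 * t^2" "c = - 2 * t^3"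
      by (simp_all add: b c eval_nat_numeral)
    \<comment> \<open>For \<open>t = r\<close> the polynomial \<open>x^3 + b*x + c\<close> is
      \<open>(x + t)^2 * (x - 2*t)\<close>, and its double root gives a singular point.\<close>
    define x :: "complex^3" where "x = vector [- t, 0, 1]"
    have "x $ 3 = 1"
      by (simp add: x_def)
    then have "x \<noteq> 0"
      by auto
    have "weierstrass b c (x + v) - weierstrass b c (x - v) - 2 * weierstrass b c v = 0" for v
      unfolding bc weierstrass_def x_def by (simp add: eval_nat_numeral algebra_simps)
    with nonsingularD[OF assms \<open>x \<noteq> 0\<close>] show False by blast
  qed
  with t(1) b c that show thesis by blast
qed

text \<open>The new coordinates are constant multiples of \<open>z\<close> and of the two factors
  \<open>y - s*(x + r*z)\<close> and \<open>y + s*(x + r*z)\<close>, inverted and scaled so that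
  \<open>x + t*z\<close> becomes \<open>v$1 + v$2 + v$3\<close>.\<close>

lemma weierstrass_triangle:
  assumes "t \<noteq> r" "s^2 = 3 * t"
  shows "weierstrass (3 * t^2 - 6 * t * r) (t^3 - 3 * t * r^2)
           (cols3 (vector [- r / (t - r), 0, 1 / (t - r)]) (vector [1, - s, 0]) (vector [1, s, 0]) *v v)
         = (v$1 + v$2 + v$3)^3 - 12 * t / (t - r) * (v$1 * v$2 * v$3)"
proof -
  define z where "z = v$1 / (t - r)"
  have v1: "v$1 = (t - r) * z"
    using assms(1) by (simp add: z_def)
  have "cols3 (vector [- r / (t - r), 0, 1 / (t - r)]) (vector [1, - s, 0]) (vector [1, s, 0]) *v v
      = vector [- r * z + v$2 + v$3, s * (v$3 - v$2), z]"
    by (simp add: cols3_mult vec_eq_iff forall_3 z_def algebra_simps)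
  moreover have "12 * t / (t - r) * (v$1 * v$2 * v$3) = 4 * s^2 * z * v$2 * v$3"
    unfolding assms(2) by (simp add: z_def)
  moreover have "weierstrass (3 * t^2 - 6 * t * r) (t^3 - 3 * t * r^2)
      (vector [- r * z + v$2 + v$3, s * (v$3 - v$2), z]) =
      ((t - r) * z + v$2 + v$3)^3 + s^2 * z * (v$3 - v$2)^2 - 3 * t * z * (v$2 + v$3)^2"
    unfolding weierstrass_def by (simp add: eval_nat_numeral algebra_simps)
  moreover have "3 * t * z * (v$2 + v$3)^2 = s^2 * z * (v$2 + v$3)^2"
    by (simp add: assms(2))
  ultimately show ?thesis
    by (simp add: v1) (simp add: eval_nat_numeral algebra_simps)
qed

text \<open>\<open>w\<close> is a primitive cube root of unity and the matrix is the Fourier matrix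
  of order 3. It turns the sum of the coordinates into \<open>3 * v$1\<close> and their product into
  \<open>x^3 + y^3 + z^3 - 3*x*y*z\<close>.\<close>

lemma triangle_hesse:
  fixes w k :: complex
  assumes w: "w^2 = - 1 - w" and u: "u = cols3 (vector [1, 1, 1]) (vector [1, w, w^2]) (vector [1, w^2, w]) *v v"
  shows "(u$1 + u$2 + u$3)^3 + k * (u$1 * u$2 * u$3) = hesse (27 + k) k k (- 3 * k) v"
proof -
  have u': "u$1 = v$1 + v$2 + v$3" "u$2 = v$1 + w * v$2 + (- 1 - w) * v$3"
    "u$3 = v$1 + (- 1 - w) * v$2 + w * v$3"
    unfolding u w by (simp_all add: cols3_mult algebra_simps)
  have "(u$1 + u$2 + u$3)^3 = (3 * v$1)^3"
    unfolding u' by (simp add: algebra_simps)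
  moreover
  have "u$2 * u$3 = (v$1)^2 + (v$2)^2 * (- w - w^2) + (v$3)^2 * (- w - w^2) - v$1 * v$2 - v$1 * v$3
      + v$2 * v$3 * (w^2 + (1 + w)^2)"
    unfolding u' by (simp add: eval_nat_numeral algebra_simps)
  then have u23: "u$2 * u$3 = (v$1)^2 + (v$2)^2 + (v$3)^2 - v$1 * v$2 - v$1 * v$3 - v$2 * v$3"
    unfolding power2_sum w by (simp add: algebra_simps)
  have "u$1 * u$2 * u$3 = (v$1 + v$2 + v$3) * (u$2 * u$3)"
    by (simp add: u'(1))
  then have "u$1 * u$2 * u$3 = (v$1)^3 + (v$2)^3 + (v$3)^3 - 3 * v$1 * v$2 * v$3"
    unfolding u23 by (simp add: eval_nat_numeral algebra_simps)
  ultimately show ?thesis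
    by (simp only: hesse_def) (simp add: algebra_simps eval_nat_numeral)
qed

text \<open>Composes the three coordinate changes. The inequalities on the coefficients make the
  linear equations for a tangent direction solvable.\<close>

lemma (in sym_trilinear) hesse_form:
  assumes "nonsingular F"
  obtains M a b c d where "det M \<noteq> 0" "\<And>v. F (M *v v) (M *v v) (M *v v) = hesse a b c d v"
    "a \<noteq> 0" "b \<noteq> 0" "c \<noteq> 0" "27 * a * b * c + d^3 \<noteq> 0"
proof -
  obtain M b c where M: "det M \<noteq> 0" "\<And>v. F (M *v v) (M *v v) (M *v v) = weierstrass b c v"
    using weierstrass_form[OF assms] by blast
  obtain t r where tr: "t \<noteq> 0" "t \<noteq> r" "b = 3 * t^2 - 6 * t * r" "c = t^3 - 3 * t * r^2"
    using weierstrass_flex_line[OF compose nonsingular_compose[OF assms M(1)] M(2)] by blast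
  obtain s where s: "s^2 = 3 * t"
    using complex_root_exists[of 2] by auto
  then have "s \<noteq> 0"
    using tr(1) by auto
  have "\<not> constant (poly [:1, 1, 1::complex:])"
    by (simp add: constant_degree)
  then obtain w where "poly [:1, 1, 1::complex:] w = 0"
    using fundamental_theorem_of_algebra by blast
  then have "w^2 + (1 + w) = 0"
    by (simp add: power2_eq_square algebra_simps)
  then have w: "w^2 = - 1 - w"
    by algebra
  define L where "L = cols3 (vector [- r / (t - r), 0, 1 / (t - r)]) (vector [1, - s, 0]) (vector [1, s, 0])"
  define E where "E = cols3 (vector [1, 1, 1]) (vector [1, w, w^2]) (vector [1, w^2, w])"
  define k where "k = - 12 * t / (t - r)"
  have "k \<noteq> 0"
    using tr by (simp add: k_def)
  have "det L = 2 * s / (t - r)"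
    by (simp add: L_def det_cols3)
  then have "det L \<noteq> 0"
    using \<open>s \<noteq> 0\<close> tr(2) by simp
  have "det E \<noteq> 0"
  proof
    assume "det E = 0"
    moreover have "det E = w^2 - (w^2)^2 + 2 * w^2 - 2 * w"
      by (simp add: E_def det_cols3 power2_eq_square algebra_simps)
    moreover have "(w^2)^2 = w"
      unfolding w using w by (simp add: power2_eq_square algebra_simps)
    ultimately have "3 * (w^2 - w) = 0"
      by (simp add: algebra_simps)
    then have "1 + 2 * w = 0"
      unfolding w by (simp add: algebra_simps)
    \<comment> \<open>The discriminant of \<open>w^2 + w + 1\<close> is \<open>-3\<close>, so its
      roots are distinct and \<open>1 + 2*w\<close> is nonzero.\<close>
    moreover have "(1 + 2 * w)^2 = 1 + 4 * w + 4 * w^2"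
      by (simp add: power2_eq_square algebra_simps)
    then have "(1 + 2 * w)^2 = - 3"
      unfolding w by simp
    ultimately show False
      by simp
  qed
  define N where "N = M ** L ** E"
  have N: "det N \<noteq> 0"
    using M(1) \<open>det L \<noteq> 0\<close> \<open>det E \<noteq> 0\<close> by (simp add: N_def det_mul)
  have F: "F (N *v v) (N *v v) (N *v v) = hesse (27 + k) k k (- 3 * k) v" for v
  proof -
    have "F (N *v v) (N *v v) (N *v v) = weierstrass b c (L *v (E *v v))"
      by (simp add: N_def M(2) flip: matrix_vector_mul_assoc)
    also have "\<dots> = ((E *v v)$1 + (E *v v)$2 + (E *v v)$3)^3 + k * ((E *v v)$1 * (E *v v)$2 * (E *v v)$3)"
      unfolding tr(3,4) L_def weierstrass_triangle[OF tr(2) s] by (simp add: k_def)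
    also have "\<dots> = hesse (27 + k) k k (- 3 * k) v"
      by (rule triangle_hesse[OF w]) (simp add: E_def)
    finally show ?thesis .
  qed
  have "27 + k \<noteq> 0"
  proof
    \<comment> \<open>Without its \<open>x^3\<close> term the Hesse form is singular at
      \<open>(1, 0, 0)\<close>.\<close>
    assume k: "27 + k = 0"
    have "hesse (27 + k) k k (- 3 * k) (axis 1 1 + v) - hesse (27 + k) k k (- 3 * k) (axis 1 1 - v)
        - 2 * hesse (27 + k) k k (- 3 * k) v = 0" for v
      unfolding k by (simp add: hesse_def axis_def eval_nat_numeral algebra_simps)
    then show False
      using nonsingularD[OF compose nonsingular_compose[OF assms N] F, of "axis 1 1"]
      by (auto simp: axis_eq_0_iff)
  qed
  moreover have "27 * (27 + k) * k * k + (- 3 * k)^3 = 729 * k^2"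
    by (simp add: eval_nat_numeral algebra_simps)
  then have "27 * (27 + k) * k * k + (- 3 * k)^3 \<noteq> 0"
    using \<open>k \<noteq> 0\<close> by simp
  ultimately show thesis
    using that[OF N F] \<open>k \<noteq> 0\<close> by blast
qed

section \<open>Moving a cubic into the tangent space\<close>

lemma (in sym_trilinear) hesse_gradient:
  assumes "\<And>v. F v v v = hesse a b c d v"
  shows "3 * F x x y = 3 * a * (x$1)^2 * y$1 + 3 * b * (x$2)^2 * y$2 + 3 * c * (x$3)^2 * y$3
    + d * (y$1 * x$2 * x$3 + x$1 * y$2 * x$3 + x$1 * x$2 * y$3)"
proof -
  have "2 * (3 * F x x y) = 2 * (3 * a * (x$1)^2 * y$1 + 3 * b * (x$2)^2 * y$2 + 3 * c * (x$3)^2 * y$3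
    + d * (y$1 * x$2 * x$3 + x$1 * y$2 * x$3 + x$1 * x$2 * y$3))"
    using polarization[of x y] unfolding assms hesse_def by (simp add: eval_nat_numeral algebra_simps)
  then show ?thesis
    by (subst (asm) mult_left_cancel) auto
qed

text \<open>Cramer's rule, with \<open>27*a*b*c + d^3\<close> as the determinant of the
  system.\<close>

lemma cyclic_system_solvable:
  fixes a b c d p q r :: complex
  assumes "27 * a * b * c + d^3 \<noteq> 0"
  obtains x y z where "3 * a * x + d * z = p" "3 * b * y + d * x = q" "3 * c * z + d * y = r"
proof
  let ?D = "27 * a * b * c + d^3"
  let ?x = "(9 * b * c * p + d^2 * q - 3 * b * d * r) / ?D"
  let ?y = "(9 * c * a * q + d^2 * r - 3 * c * d * p) / ?D"
  let ?z = "(9 * a * b * r + d^2 * p - 3 * a * d * q) / ?D"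
  have "3 * a * (9 * b * c * p + d^2 * q - 3 * b * d * r) + d * (9 * a * b * r + d^2 * p - 3 * a * d * q) = p * ?D"
    "3 * b * (9 * c * a * q + d^2 * r - 3 * c * d * p) + d * (9 * b * c * p + d^2 * q - 3 * b * d * r) = q * ?D"
    "3 * c * (9 * a * b * r + d^2 * p - 3 * a * d * q) + d * (9 * c * a * q + d^2 * r - 3 * c * d * p) = r * ?D"
    by (simp_all add: eval_nat_numeral algebra_simps)
  then show "3 * a * ?x + d * ?z = p" "3 * b * ?y + d * ?x = q" "3 * c * ?z + d * ?y = r"
    using assms by (simp_all only: times_divide_eq_right add_divide_distrib[symmetric]) simp_all
qed

context sym_trilinear
begin

text \<open>Diagonalizes the symmetric bilinear form \<open>F u\<close>: first the non-isotropic
  \<open>u\<close> is split off, then the form is made diagonal on the orthogonal plane.\<close>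

lemma orthogonal_basis:
  assumes "F u u u \<noteq> 0"
  obtains v w where "det (cols3 u v w) \<noteq> 0" "F u v w = 0" "F u u v = 0" "F u u w = 0"
proof -
  have "u \<noteq> 0"
    using assms by auto
  obtain p0 where p0: "\<And>k. p0 \<noteq> k *s u"
  proof (rule ccontr)
    assume "\<not> thesis"
    then have *: "\<exists>k. p = k *s u" for p
      using that by blast
    obtain k1 k2 where k: "axis 1 1 = k1 *s u" "axis 2 1 = k2 *s u"
      using * by metis
    have "k1 * u$1 = 1" "k1 * u$2 = 0" "k2 * u$2 = 1"
      using arg_cong[OF k(1), of "\<lambda>v. v$1"] arg_cong[OF k(1), of "\<lambda>v. v$2"] arg_cong[OF k(2), of "\<lambda>v. v$2"]
      by (simp_all add: axis_def)
    then show False by auto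
  qed
  obtain q0 where q0: "det (cols3 p0 u q0) \<noteq> 0"
    using extend_to_cols3[OF \<open>u \<noteq> 0\<close> p0] .
  \<comment> \<open>Projections to the orthogonal complement of \<open>u\<close>.\<close>
  define p where "p = p0 + (- F u u p0 / F u u u) *s u"
  define q where "q = q0 + (- F u u q0 / F u u u) *s u"
  have pq: "F u u p = 0" "F u u q = 0"
    unfolding p_def q_def expand using assms by simp_all
  have "det (cols3 u p q) = - det (cols3 p0 u q0)"
    by (simp add: p_def q_def det_cols3 algebra_simps)
  then have det: "det (cols3 u p q) \<noteq> 0"
    using q0 by simp
  have qp: "F u q p = F u p q"
    by (rule swaps)
  consider "F u p p \<noteq> 0" | "F u q q \<noteq> 0" | "F u p p = 0" "F u q q = 0"
    by blast
  then show thesis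
  proof cases
    case 1
    let ?v = "q + (- F u p q / F u p p) *s p"
    have "det (cols3 u ?v p) = - det (cols3 u p q)"
      by (simp add: det_cols3 algebra_simps)
    moreover have "F u ?v p = 0" "F u u ?v = 0"
      unfolding expand pq qp using 1 by simp_all
    ultimately show thesis
      using that[of ?v p] det pq by simp
  next
    case 2
    let ?v = "p + (- F u p q / F u q q) *s q"
    have "det (cols3 u ?v q) = det (cols3 u p q)"
      by (simp add: det_cols3 algebra_simps)
    moreover have "F u ?v q = 0" "F u u ?v = 0"
      unfolding expand pq qp using 2 by simp_all
    ultimately show thesis
      using that[of ?v q] det pq by simp
  next
    case 3
    \<comment> \<open>For isotropic \<open>p\<close> and \<open>q\<close>, difference and sum are
      orthogonal, since the mixed terms cancel.\<close>
    let ?v = "p + (- 1) *s q" and ?w = "p + q"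
    have "det (cols3 u ?v ?w) = 2 * det (cols3 u p q)"
      by (simp add: det_cols3 algebra_simps)
    moreover have "F u ?v ?w = 0" "F u u ?v = 0" "F u u ?w = 0"
      unfolding expand pq qp 3 by simp_all
    ultimately show thesis
      using that[of ?v ?w] det pq by simp
  qed
qed

lemma basis_in_tangent_space:
  assumes abc: "a \<noteq> 0" "b \<noteq> 0" "c \<noteq> 0"
  obtains u v w where "det (cols3 u v w) \<noteq> 0" "F u v w = 0"
    "F u u u / a + F v v v / b + F w w w / c = 0"
proof (cases "\<forall>u. F u u u = 0")
  case True
  \<comment> \<open>A symmetric form with zero diagonal is zero, and then any basis will do.\<close>
  then have "6 * F x x y = 0" for x y
    unfolding polarization by simp
  then have 0: "F x x y = 0" for x y
    by simp
  have "F x y z = 0" for x y z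
  proof -
    have "F x y z + F y x z = 0"
      using 0[of "x + y" z] unfolding add1 add2 by (simp add: 0 add.commute)
    then show ?thesis
      by (simp add: swap12[of y x])
  qed
  then show thesis
    using that[of "axis 1 1" "axis 2 1" "axis 3 1"] by (simp add: det_cols3 axis_def)
next
  case False
  then obtain u where u: "F u u u \<noteq> 0"
    by blast
  obtain v0 w where vw: "det (cols3 u v0 w) \<noteq> 0" "F u v0 w = 0" "F u u v0 = 0" "F u u w = 0"
    using orthogonal_basis[OF u] .
  \<comment> \<open>Adding multiples of \<open>u\<close> to \<open>v0\<close> preserves
    \<open>F u v w = 0\<close>, because \<open>F u u w = 0\<close>.\<close>
  obtain x where x: "F (v0 + x *s u) (v0 + x *s u) (v0 + x *s u) \<noteq> 0"
  proof (rule ccontr)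
    assume "\<not> thesis"
    then have *: "F (v0 + x *s u) (v0 + x *s u) (v0 + x *s u) = 0" for x
      using that by blast
    have eq: "F (v0 + x *s u) (v0 + x *s u) (v0 + x *s u) = F v0 v0 v0 + 3 * x * F u v0 v0 + x^3 * F u u u" for x
    proof -
      have "F v0 u u = F u u v0" "F u v0 u = F u u v0" "F v0 u v0 = F u v0 v0" "F v0 v0 u = F u v0 v0"
        by (rule swaps)+
      then show ?thesis
        using vw(3) by (simp add: expand power3_eq_cube algebra_simps)
    qed
    \<comment> \<open>The polynomial in \<open>x\<close> has no quadratic term, so its zeros at 0, 1
      and 2 force the leading coefficient \<open>F u u u\<close> to vanish.\<close>
    have "F v0 v0 v0 = 0" "3 * F u v0 v0 + F u u u = 0" "3 * 2 * F u v0 v0 + 8 * F u u u = 0"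
      using *[of 0] *[of 1] *[of 2] unfolding eq by simp_all
    then have "6 * F u u u = 0"
      by algebra
    then show False
      using u by simp
  qed
  define v where "v = v0 + x *s u"
  have v: "F v v v \<noteq> 0" "F u v w = 0"
    using x vw by (simp_all add: v_def expand)
  have det: "det (cols3 u v w) \<noteq> 0"
    using vw(1) by (simp add: v_def det_cols3 algebra_simps)
  \<comment> \<open>The sum of the other two terms must be nonzero for the scaling factor
    \<open>t\<close> of \<open>v\<close> to be nonzero; if \<open>s = 1\<close> fails, then
    \<open>s = 2\<close> works.\<close>
  obtain s where s: "s \<noteq> 0" "s^3 * F u u u / a + F w w w / c \<noteq> 0"
  proof (cases "F u u u / a + F w w w / c = 0")
    case True
    then have "F w w w / c = - (F u u u / a)"
      by (simp add: eq_neg_iff_add_eq_0 add.commute)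
    then have "2^3 * F u u u / a + F w w w / c = 7 * (F u u u / a)"
      by (simp del: times_divide_eq_right add: times_divide_eq_right[symmetric])
    then show thesis
      using that[of 2] u abc by simp
  next
    case False
    then show thesis
      using that[of 1] by simp
  qed
  obtain t where t: "t^3 = - b * (s^3 * F u u u / a + F w w w / c) / F v v v"
    using complex_root_exists[of 3] by auto
  have "t \<noteq> 0"
    using t s v abc by auto
  have "det (cols3 (s *s u) (t *s v) w) = s * t * det (cols3 u v w)"
    by (simp add: det_cols3 algebra_simps)
  then have "det (cols3 (s *s u) (t *s v) w) \<noteq> 0"
    using s(1) \<open>t \<noteq> 0\<close> det by simp
  moreover have "F (s *s u) (t *s v) w = 0"
    by (simp add: expand v)
  moreover have "F (s *s u) (s *s u) (s *s u) / a + F (t *s v) (t *s v) (t *s v) / b + F w w w / c = 0"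
  proof -
    have "t^3 * F v v v / b = - (s^3 * F u u u / a + F w w w / c)"
      using t v abc by simp
    then show ?thesis
      by (simp add: expand power3_eq_cube mult.assoc)
  qed
  ultimately show thesis
    using that by blast
qed

end

text \<open>Coefficients are compared in Hesse coordinates for \<open>F\<close> and the adapted
  basis for \<open>H\<close>. The cubes determine the diagonal of \<open>\<eta>\<close>, whose trace
  vanishes by the choice of basis; the mixed terms determine the other entries.\<close>

theorem cubic_meets_tangent_space:
  assumes "sym_trilinear F" "nonsingular F" "sym_trilinear H"
  obtains M K \<eta> where "det M \<noteq> 0" "det K \<noteq> 0" "trace \<eta> = 0"
    "\<And>v. H (K *v v) (K *v v) (K *v v) = 3 * F (M *v v) (M *v v) (M *v (\<eta> *v v))"
proof -
  interpret F: sym_trilinear F by fact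
  interpret H: sym_trilinear H by fact
  obtain M a b c d where M: "det M \<noteq> 0" "\<And>v. F (M *v v) (M *v v) (M *v v) = hesse a b c d v"
    "a \<noteq> 0" "b \<noteq> 0" "c \<noteq> 0" "27 * a * b * c + d^3 \<noteq> 0"
    using F.hesse_form[OF assms(2)] by blast
  obtain u v w where uvw: "det (cols3 u v w) \<noteq> 0" "H u v w = 0"
    "H u u u / a + H v v v / b + H w w w / c = 0"
    using H.basis_in_tangent_space[OF M(3,4,5)] by blast
  \<comment> \<open>The six equations for the off-diagonal entries separate into two cyclic systems,
    of which the second has \<open>b\<close> and \<open>c\<close> exchanged.\<close>
  obtain x12 x23 x31 where x: "3 * a * x12 + d * x31 = 3 * H u u v"
    "3 * b * x23 + d * x12 = 3 * H v v w" "3 * c * x31 + d * x23 = 3 * H u w w"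
    using cyclic_system_solvable[OF M(6)] by blast
  have "27 * a * c * b + d^3 \<noteq> 0"
    using M(6) by (simp add: ac_simps)
  then obtain x13 x32 x21 where y: "3 * a * x13 + d * x21 = 3 * H u u w"
    "3 * c * x32 + d * x13 = 3 * H v w w" "3 * b * x21 + d * x32 = 3 * H u v v"
    using cyclic_system_solvable by blast
  define h1 h2 h3 where "h1 = H u u u / (3 * a)" and "h2 = H v v v / (3 * b)" and "h3 = H w w w / (3 * c)"
  have h: "3 * a * h1 = H u u u" "3 * b * h2 = H v v v" "3 * c * h3 = H w w w"
    using M(3,4,5) by (simp_all add: h1_def h2_def h3_def)
  have tr: "h1 + h2 + h3 = 0"
    using arg_cong[OF uvw(3), of "\<lambda>z. z / 3"]
    by (simp add: h1_def h2_def h3_def add_divide_distrib mult.commute)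
  define \<eta> :: "complex^3^3" where
    "\<eta> = vector [vector [h1, x12, x13], vector [x21, h2, x23], vector [x31, x32, h3]]"
  have trace: "trace \<eta> = 0"
    unfolding trace_def sum_3 \<eta>_def vector_3 by (rule tr)
  have "H (cols3 u v w *v z) (cols3 u v w *v z) (cols3 u v w *v z) =
      3 * F (M *v z) (M *v z) (M *v (\<eta> *v z))" for z
  proof -
    have \<eta>: "(\<eta> *v z)$1 = h1 * z$1 + x12 * z$2 + x13 * z$3"
      "(\<eta> *v z)$2 = x21 * z$1 + h2 * z$2 + x23 * z$3"
      "(\<eta> *v z)$3 = x31 * z$1 + x32 * z$2 + h3 * z$3"
      by (simp_all add: \<eta>_def matrix_vector_mult_def sum_3)
    have "3 * F (M *v z) (M *v z) (M *v (\<eta> *v z)) =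
      3 * a * h1 * (z$1)^3 + 3 * b * h2 * (z$2)^3
      + 3 * c * h3 * (z$3)^3
      + (3 * a * x12 + d * x31) * ((z$1)^2 * z$2) + (3 * a * x13 + d * x21) * ((z$1)^2 * z$3)
      + (3 * b * x21 + d * x32) * (z$1 * (z$2)^2) + (3 * b * x23 + d * x12) * ((z$2)^2 * z$3)
      + (3 * c * x31 + d * x23) * (z$1 * (z$3)^2) + (3 * c * x32 + d * x13) * (z$2 * (z$3)^2)
      + d * (h1 + h2 + h3) * (z$1 * z$2 * z$3)"
      unfolding sym_trilinear.hesse_gradient[OF F.compose M(2)] \<eta>
      by (simp only: power2_eq_square power3_eq_cube distrib_left distrib_right mult.assoc)
         (simp only: ac_simps)
    also have "\<dots> = H (cols3 u v w *v z) (cols3 u v w *v z) (cols3 u v w *v z)"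
      unfolding h x y tr cols3_mult H.sym_diag_expand uvw(2) by (simp add: mult_ac)
    finally show ?thesis by simp
  qed
  with that M(1) uvw(1) trace show thesis by blast
qed

section \<open>Evaluation of polynomials\<close>

definition monom_val :: "('v \<Rightarrow>\<^sub>0 nat) \<Rightarrow> ('v \<Rightarrow> complex) \<Rightarrow> complex" where
  "monom_val m x = (\<Prod>v\<in>Poly_Mapping.keys m. x v ^ Poly_Mapping.lookup m v)"

lemma monom_val_superset:
  assumes "finite A" "Poly_Mapping.keys m \<subseteq> A"
  shows "monom_val m x = (\<Prod>v\<in>A. x v ^ Poly_Mapping.lookup m v)"
  unfolding monom_val_def using assms by (intro prod.mono_neutral_left) (auto simp: in_keys_iff)

lemma monom_val_add: "monom_val (m + n) x = monom_val m x * monom_val n x"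
proof -
  let ?A = "Poly_Mapping.keys m \<union> Poly_Mapping.keys n"
  have "monom_val (m + n) x = (\<Prod>v\<in>?A. x v ^ Poly_Mapping.lookup (m + n) v)"
    by (rule monom_val_superset) (auto dest: subsetD[OF keys_add])
  also have "\<dots> = monom_val m x * monom_val n x"
    by (simp add: monom_val_superset[of ?A] lookup_add power_add prod.distrib)
  finally show ?thesis .
qed

lemma monom_val_0 [simp]: "monom_val 0 x = 1"
  by (simp add: monom_val_def)

lemma monom_val_single: "monom_val (Poly_Mapping.single v n) x = x v ^ n"
  by (simp add: monom_val_def)

lemma ceval_superset:
  assumes "finite A" "Poly_Mapping.keys P \<subseteq> A"
  shows "ceval P x = (\<Sum>m\<in>A. Poly_Mapping.lookup P m * monom_val m x)"
  unfolding ceval_def monom_val_def[symmetric]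
  using assms by (intro sum.mono_neutral_left) (auto simp: in_keys_iff)

lemma ceval_0 [simp]: "ceval 0 x = 0"
  by (simp add: ceval_def)

lemma ceval_add [simp]: "ceval (P + Q) x = ceval P x + ceval Q x"
proof -
  let ?A = "Poly_Mapping.keys P \<union> Poly_Mapping.keys Q"
  have "ceval (P + Q) x = (\<Sum>m\<in>?A. Poly_Mapping.lookup (P + Q) m * monom_val m x)"
    by (rule ceval_superset) (auto dest: subsetD[OF keys_add])
  also have "\<dots> = ceval P x + ceval Q x"
    by (simp add: ceval_superset[of ?A] lookup_add sum.distrib algebra_simps)
  finally show ?thesis .
qed

lemma ceval_uminus [simp]: "ceval (- P) x = - ceval P x"
  by (simp add: ceval_def sum_negf)

lemma ceval_sum [simp]: "ceval (\<Sum>i\<in>A. P i) x = (\<Sum>i\<in>A. ceval (P i) x)"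
  by (induction A rule: infinite_finite_induct) simp_all

lemma ceval_single: "ceval (Poly_Mapping.single m c) x = c * monom_val m x"
  using ceval_superset[of "{m}" "Poly_Mapping.single m c" x] by simp

lemma cpoly_sum_singles:
  "P = (\<Sum>m\<in>Poly_Mapping.keys P. Poly_Mapping.single m (Poly_Mapping.lookup P m))"
proof (rule poly_mapping_eqI)
  fix k
  show "Poly_Mapping.lookup P k =
    Poly_Mapping.lookup (\<Sum>m\<in>Poly_Mapping.keys P. Poly_Mapping.single m (Poly_Mapping.lookup P m)) k"
    by (cases "k \<in> Poly_Mapping.keys P")
      (simp_all add: lookup_sum lookup_single when_def sum.delta in_keys_iff cong: if_cong)
qed

lemma ceval_mult [simp]: "ceval (P * Q) x = ceval P x * ceval Q x"
proof -
  have "P * Q = (\<Sum>m\<in>Poly_Mapping.keys P. \<Sum>n\<in>Poly_Mapping.keys Q.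
      Poly_Mapping.single (m + n) (Poly_Mapping.lookup P m * Poly_Mapping.lookup Q n))"
    by (subst cpoly_sum_singles[of P], subst cpoly_sum_singles[of Q])
      (simp add: sum_product mult_single)
  then have "ceval (P * Q) x = (\<Sum>m\<in>Poly_Mapping.keys P. \<Sum>n\<in>Poly_Mapping.keys Q.
      (Poly_Mapping.lookup P m * monom_val m x) * (Poly_Mapping.lookup Q n * monom_val n x))"
    by (simp add: ceval_single monom_val_add mult_ac)
  also have "\<dots> = ceval P x * ceval Q x"
    by (simp add: ceval_def monom_val_def sum_product)
  finally show ?thesis .
qed

lemma ceval_cconst [simp]: "ceval (cconst c) x = c"
  by (simp add: cconst_def ceval_single)

lemma ceval_cvar [simp]: "ceval (cvar v) x = x v"
  by (simp add: cvar_def ceval_single monom_val_single)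

lemma ceval_1 [simp]: "ceval 1 x = 1"
  using ceval_cconst[of 1] by (simp add: cconst_def)

lemma ceval_power [simp]: "ceval (P ^ n) x = ceval P x ^ n"
  by (induction n) simp_all

lemma ceval_prod [simp]: "ceval (\<Prod>i\<in>A. P i) x = (\<Prod>i\<in>A. ceval (P i) x)"
  by (induction A rule: infinite_finite_induct) simp_all

lemma ceval_csubst: "ceval (csubst P q) x = ceval P (\<lambda>v. ceval (q v) x)"
  by (simp add: csubst_def) (simp add: ceval_def)

section \<open>Homogeneous polynomials\<close>

definition homogeneous :: "nat \<Rightarrow> 'v::finite cpoly \<Rightarrow> bool" where
  "homogeneous d P \<longleftrightarrow> (\<forall>m\<in>Poly_Mapping.keys P. (\<Sum>i\<in>UNIV. Poly_Mapping.lookup m i) = d)"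

lemma homogeneous_0 [simp]: "homogeneous d 0"
  by (simp add: homogeneous_def)

lemma homogeneous_add: "homogeneous d P \<Longrightarrow> homogeneous d Q \<Longrightarrow> homogeneous d (P + Q)"
  unfolding homogeneous_def using keys_add[of P Q] by blast

lemma homogeneous_uminus: "homogeneous d P \<Longrightarrow> homogeneous d (- P)"
  by (simp add: homogeneous_def in_keys_iff)

lemma homogeneous_sum: "(\<And>i. i \<in> A \<Longrightarrow> homogeneous d (P i)) \<Longrightarrow> homogeneous d (\<Sum>i\<in>A. P i)"
  by (induction A rule: infinite_finite_induct) (auto intro: homogeneous_add)

lemma homogeneous_mult: "homogeneous d P \<Longrightarrow> homogeneous e Q \<Longrightarrow> homogeneous (d + e) (P * Q)"
  unfolding homogeneous_def using keys_mult[of P Q] by (force simp: lookup_add sum.distrib)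

lemma homogeneous_single: "c = 0 \<or> (\<Sum>i\<in>UNIV. Poly_Mapping.lookup m i) = d \<Longrightarrow> homogeneous d (Poly_Mapping.single m c)"
  by (auto simp: homogeneous_def)

lemma homogeneous_cconst: "homogeneous 0 (cconst c)"
  unfolding cconst_def by (rule homogeneous_single) simp

lemma homogeneous_cvar: "homogeneous 1 (cvar v)"
  unfolding cvar_def by (rule homogeneous_single) (simp add: lookup_single when_def)

lemma homogeneous_power: "homogeneous d P \<Longrightarrow> homogeneous (n * d) (P ^ n)"
  by (induction n) (use homogeneous_cconst[of 1] in \<open>auto simp: cconst_def intro: homogeneous_mult\<close>)

lemma homogeneous_prod:
  "finite A \<Longrightarrow> (\<And>i. i \<in> A \<Longrightarrow> homogeneous (d i) (P i)) \<Longrightarrow> homogeneous (\<Sum>i\<in>A. d i) (\<Prod>i\<in>A. P i)"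
  by (induction A rule: finite_induct) (use homogeneous_cconst[of 1] in \<open>auto simp: cconst_def intro: homogeneous_mult\<close>)

lemma homogeneous_csubst:
  assumes "homogeneous d P" "\<And>v. homogeneous 1 (q v)"
  shows "homogeneous d (csubst P q)"
  unfolding csubst_def
proof (rule homogeneous_sum)
  fix m
  assume m: "m \<in> Poly_Mapping.keys P"
  have "homogeneous (\<Sum>v\<in>Poly_Mapping.keys m. Poly_Mapping.lookup m v * 1)
      (\<Prod>v\<in>Poly_Mapping.keys m. q v ^ Poly_Mapping.lookup m v)"
    by (intro homogeneous_prod homogeneous_power assms finite_keys)
  also have "(\<Sum>v\<in>Poly_Mapping.keys m. Poly_Mapping.lookup m v * 1) = (\<Sum>v\<in>UNIV. Poly_Mapping.lookup m v)"
    by simp (rule sum.mono_neutral_left, auto simp: in_keys_iff)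
  also have "\<dots> = d"
    using assms(1) m by (simp add: homogeneous_def)
  finally show "homogeneous d (cconst (Poly_Mapping.lookup P m) *
      (\<Prod>v\<in>Poly_Mapping.keys m. q v ^ Poly_Mapping.lookup m v))"
    using homogeneous_mult[OF homogeneous_cconst] by fastforce
qed

lemma lookup_cubic_form: "Poly_Mapping.lookup (cubic_form b) (expo I) = b $ I"
proof -
  have "(expo J = expo I) = (J = I)" for J
    by (rule expo_inject)
  then show ?thesis
    by (simp add: cubic_form_def xmon_def cconst_def mult_single lookup_sum lookup_single when_def)
qed

lemma cubic_form_sum: "cubic_form b = (\<Sum>I\<in>UNIV. Poly_Mapping.single (expo I) (b $ I))"
  by (simp add: cubic_form_def xmon_def cconst_def mult_single)

lemma homogeneous_cubic_form: "homogeneous 3 (cubic_form b)"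
  unfolding cubic_form_sum using expo by (intro homogeneous_sum homogeneous_single) auto

text \<open>\<open>cubic_coeffs\<close> reads only the part of degree 3. Homogeneity ensures that
  nothing is lost in the two actions, which are defined through it.\<close>

lemma cubic_form_cubic_coeffs:
  assumes "homogeneous 3 p"
  shows "cubic_form (cubic_coeffs p) = p"
proof (rule poly_mapping_eqI)
  fix m
  show "Poly_Mapping.lookup (cubic_form (cubic_coeffs p)) m = Poly_Mapping.lookup p m"
  proof (cases "(\<Sum>i\<in>UNIV. Poly_Mapping.lookup m i) = 3")
    case True
    then obtain I where "m = expo I"
      using Abs_cubic_idx_inverse[of m] by (metis mem_Collect_eq)
    then show ?thesis
      by (simp add: lookup_cubic_form cubic_coeffs_def)
  next
    case False
    then show ?thesis
      using assms homogeneous_cubic_form[of "cubic_coeffs p"] unfolding homogeneous_def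
      by (metis not_in_keys_iff_lookup_eq_zero)
  qed
qed

lemma homogeneous_cpderiv:
  assumes "homogeneous (Suc d) P"
  shows "homogeneous d (cpderiv v P)"
  unfolding cpderiv_def
proof (intro homogeneous_sum homogeneous_single)
  fix m
  assume m: "m \<in> Poly_Mapping.keys P"
  show "of_nat (Poly_Mapping.lookup m v) * Poly_Mapping.lookup P m = 0
      \<or> (\<Sum>i\<in>UNIV. Poly_Mapping.lookup (m - Poly_Mapping.single v 1) i) = d"
  \<comment> \<open>If the variable does not occur, the exponent subtraction truncates, but the
    coefficient is zero.\<close>
  proof (cases "Poly_Mapping.lookup m v = 0")
    case False
    then have "m = (m - Poly_Mapping.single v 1) + Poly_Mapping.single v 1"
      by (intro poly_mapping_eqI) (auto simp: lookup_add lookup_minus lookup_single when_def)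
    then have "(\<Sum>i\<in>UNIV. Poly_Mapping.lookup m i) =
        (\<Sum>i\<in>UNIV. Poly_Mapping.lookup (m - Poly_Mapping.single v 1) i + Poly_Mapping.lookup (Poly_Mapping.single v (1::nat)) i)"
      by (metis (no_types, lifting) lookup_add sum.cong)
    also have "\<dots> = (\<Sum>i\<in>UNIV. Poly_Mapping.lookup (m - Poly_Mapping.single v 1) i) + 1"
      by (simp add: sum.distrib lookup_single when_def)
    finally show ?thesis
      using assms m by (simp add: homogeneous_def)
  qed simp
qed

section \<open>Cubic forms and their polarizations\<close>

abbreviation cubic_val :: "cubic_space \<Rightarrow> complex^3 \<Rightarrow> complex" where
  "cubic_val b x \<equiv> ceval (cubic_form b) (($) x)"

lemma cubic_val_sum: "cubic_val b x = (\<Sum>I\<in>UNIV. b $ I * monom_val (expo I) (($) x))"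
  by (simp add: cubic_form_sum ceval_single)

section \<open>Cubic monomials as products of variables, and their derivatives\<close>

lemma split_variable:
  fixes m :: "'v::finite \<Rightarrow>\<^sub>0 nat"
  assumes "(\<Sum>i\<in>UNIV. Poly_Mapping.lookup m i) = Suc d"
  obtains i m' where "m = Poly_Mapping.single i 1 + m'" "(\<Sum>i\<in>UNIV. Poly_Mapping.lookup m' i) = d"
proof -
  obtain i where "Poly_Mapping.lookup m i \<noteq> 0"
    using assms by (metis nat.distinct(1) sum.neutral)
  then have m: "m = Poly_Mapping.single i 1 + (m - Poly_Mapping.single i 1)"
    by (intro poly_mapping_eqI) (auto simp: lookup_add lookup_minus lookup_single when_def)
  have "(\<Sum>j\<in>UNIV. Poly_Mapping.lookup (Poly_Mapping.single i 1 + (m - Poly_Mapping.single i 1)) j) = Suc d"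
    using assms m by simp
  then have "(\<Sum>j\<in>UNIV. Poly_Mapping.lookup (m - Poly_Mapping.single i 1) j) = d"
    by (simp only: lookup_add sum.distrib) (simp add: lookup_single when_def)
  with m that show thesis by blast
qed

lemma expo_split:
  obtains i j k where "expo I = Poly_Mapping.single i 1 + (Poly_Mapping.single j 1 + Poly_Mapping.single k 1)"
proof -
  have "(\<Sum>i\<in>UNIV. Poly_Mapping.lookup (expo I) i) = Suc (Suc (Suc 0))"
    using expo[of I] by simp
  then obtain i m1 where 1: "expo I = Poly_Mapping.single i 1 + m1" "(\<Sum>i\<in>UNIV. Poly_Mapping.lookup m1 i) = Suc (Suc 0)"
    by (rule split_variable)
  from 1(2) obtain j m2 where 2: "m1 = Poly_Mapping.single j 1 + m2" "(\<Sum>i\<in>UNIV. Poly_Mapping.lookup m2 i) = Suc 0"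
    by (rule split_variable)
  from 2(2) obtain k m3 where 3: "m2 = Poly_Mapping.single k 1 + m3" "(\<Sum>i\<in>UNIV. Poly_Mapping.lookup m3 i) = 0"
    by (rule split_variable)
  have "m3 = 0"
    using 3(2) by (intro poly_mapping_eqI) simp
  with 1 2 3 that show thesis by simp
qed

text \<open>The derivative of the monomial at \<open>x\<close> in direction
  \<open>y\<close>.\<close>

definition monom_diff :: "('v::finite \<Rightarrow>\<^sub>0 nat) \<Rightarrow> ('v \<Rightarrow> complex) \<Rightarrow> ('v \<Rightarrow> complex) \<Rightarrow> complex" where
  "monom_diff m x y = (\<Sum>v\<in>UNIV. y v * (of_nat (Poly_Mapping.lookup m v) * monom_val (m - Poly_Mapping.single v 1) x))"

lemma monom_diff_0 [simp]: "monom_diff 0 x y = 0"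
  by (simp add: monom_diff_def)

text \<open>Product rule for one factor; three applications differentiate a cubic monomial.\<close>

lemma monom_diff_single_add:
  "monom_diff (Poly_Mapping.single i 1 + m) x y = y i * monom_val m x + x i * monom_diff m x y"
proof -
  have "y v * (of_nat (Poly_Mapping.lookup (Poly_Mapping.single i 1 + m) v) *
        monom_val (Poly_Mapping.single i 1 + m - Poly_Mapping.single v 1) x) =
      (if v = i then y i * monom_val m x else 0) +
      x i * (y v * (of_nat (Poly_Mapping.lookup m v) * monom_val (m - Poly_Mapping.single v 1) x))" for v
  proof (cases "Poly_Mapping.lookup m v = 0")
    case True
    then show ?thesis
      by (auto simp: lookup_add lookup_single when_def)
  next
    case False
    then have "Poly_Mapping.single i 1 + m - Poly_Mapping.single v 1 =
        Poly_Mapping.single i 1 + (m - Poly_Mapping.single v 1)"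
      "m = Poly_Mapping.single v 1 + (m - Poly_Mapping.single v 1)"
      by (auto intro!: poly_mapping_eqI simp: lookup_add lookup_minus lookup_single when_def)
    then have "monom_val (Poly_Mapping.single i 1 + m - Poly_Mapping.single v 1) x =
        x i * monom_val (m - Poly_Mapping.single v 1) x"
      "monom_val m x = x v * monom_val (m - Poly_Mapping.single v 1) x"
      by (metis monom_val_add monom_val_single power_one_right)+
    then show ?thesis
      by (auto simp: lookup_add lookup_single when_def algebra_simps)
  qed
  then show ?thesis
    by (simp add: monom_diff_def sum.distrib sum_distrib_left)
qed

lemma ceval_cpderiv_superset:
  assumes "finite A" "Poly_Mapping.keys P \<subseteq> A"
  shows "ceval (cpderiv v P) x = (\<Sum>m\<in>A. of_nat (Poly_Mapping.lookup m v) * Poly_Mapping.lookup P m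
    * monom_val (m - Poly_Mapping.single v 1) x)"
  unfolding cpderiv_def ceval_sum ceval_single
  using assms by (intro sum.mono_neutral_left) (auto simp: in_keys_iff)

lemma gradient_sum:
  "(\<Sum>i\<in>UNIV. y $ i * ceval (cpderiv i (cubic_form b)) (($) x)) =
   (\<Sum>I\<in>UNIV. b $ I * monom_diff (expo I) (($) x) (($) y))"
proof -
  have "Poly_Mapping.keys (cubic_form b) \<subseteq> range expo"
  proof
    fix m
    assume "m \<in> Poly_Mapping.keys (cubic_form b)"
    then have "(\<Sum>i\<in>UNIV. Poly_Mapping.lookup m i) = 3"
      using homogeneous_cubic_form unfolding homogeneous_def by blast
    then have "expo (Abs_cubic_idx m) = m"
      by (simp add: Abs_cubic_idx_inverse)
    then show "m \<in> range expo"
      by (metis rangeI)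
  qed
  moreover have "inj expo"
    by (simp add: inj_def expo_inject)
  ultimately have "ceval (cpderiv i (cubic_form b)) (($) x) =
      (\<Sum>I\<in>UNIV. of_nat (Poly_Mapping.lookup (expo I) i) * b $ I * monom_val (expo I - Poly_Mapping.single i 1) (($) x))" for i
    by (simp add: ceval_cpderiv_superset[of "range expo"] sum.reindex lookup_cubic_form)
  then show ?thesis
    unfolding monom_diff_def sum_distrib_left
    by simp (subst sum.swap, simp add: sum_distrib_left mult_ac)
qed

lemma cubic_polar_form:
  obtains F where "sym_trilinear F" "\<And>x. F x x x = cubic_val b x"
proof -
  have "\<forall>I. \<exists>i j k. expo I = Poly_Mapping.single i 1 + (Poly_Mapping.single j 1 + Poly_Mapping.single k 1)"
    using expo_split by metis
  then obtain i j k where e: "\<And>I. expo I =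
      Poly_Mapping.single (i I) 1 + (Poly_Mapping.single (j I) 1 + Poly_Mapping.single (k I) 1)"
    by metis
  \<comment> \<open>The polarization of a product of three variables: the average over the six
    permutations of the arguments.\<close>
  define T where "T I u v w = (u $ i I * v $ j I * w $ k I + u $ i I * w $ j I * v $ k I
     + v $ i I * u $ j I * w $ k I + v $ i I * w $ j I * u $ k I
     + w $ i I * u $ j I * v $ k I + w $ i I * v $ j I * u $ k I) / 6" for I and u v w :: "complex^3"
  define F where "F u v w = (\<Sum>I\<in>UNIV. b $ I * T I u v w)" for u v w
  have T: "T I (u + u') v w = T I u v w + T I u' v w" "T I u (v + v') w = T I u v w + T I u v' w"
    "T I u v (w + w') = T I u v w + T I u v w'" "T I (c *s u) v w = c * T I u v w"
    "T I u (c *s v) w = c * T I u v w" "T I u v (c *s w) = c * T I u v w"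
    for I u u' v v' w w' c
    by (simp_all add: T_def field_simps)
  have T': "T I u v w = T I v u w" "T I u v w = T I u w v" for I u v w
    by (simp_all add: T_def add_ac)
  have "sym_trilinear F"
  proof
    show "F u v w = F v u w" "F u v w = F u w v" for u v w
      unfolding F_def using T' by (auto intro!: sum.cong)
  qed (simp_all add: F_def T algebra_simps sum.distrib sum_distrib_left)
  moreover have "F x x x = cubic_val b x" for x
    by (simp add: F_def T_def cubic_val_sum e monom_val_add monom_val_single)
  ultimately show thesis
    using that by blast
qed

text \<open>Polarization expresses \<open>F x x y\<close> through the values of the cubic; the
  identity is then checked on each monomial by the product rule.\<close>

lemma gradient_unique:
  assumes "sym_trilinear F" "\<And>x. F x x x = cubic_val b x"
  shows "3 * F x x y = (\<Sum>i\<in>UNIV. y $ i * ceval (cpderiv i (cubic_form b)) (($) x))"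
proof -
  interpret sym_trilinear F by fact
  have "6 * F x x y = (\<Sum>I\<in>UNIV. b $ I * (monom_val (expo I) (($) (x + y)) - monom_val (expo I) (($) (x - y))
      - 2 * monom_val (expo I) (($) y)))"
    unfolding polarization assms(2) cubic_val_sum
    by (simp add: sum_subtractf sum.distrib sum_distrib_left algebra_simps)
  also have "\<dots> = (\<Sum>I\<in>UNIV. b $ I * (2 * monom_diff (expo I) (($) x) (($) y)))"
  proof (intro sum.cong refl arg_cong[where f = "\<lambda>z. _ * z"])
    fix I
    obtain i j k where e: "expo I = Poly_Mapping.single i 1 + (Poly_Mapping.single j 1 + Poly_Mapping.single k 1)"
      using expo_split .
    have "monom_diff (Poly_Mapping.single k 1) (($) x) (($) y) = y $ k"
      using monom_diff_single_add[of k 0] by simp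
    then have d: "monom_diff (expo I) (($) x) (($) y) = y $ i * (x $ j * x $ k) + x $ i * (y $ j * x $ k + x $ j * y $ k)"
      unfolding e monom_diff_single_add by (simp add: monom_val_add monom_val_single)
    show "monom_val (expo I) (($) (x + y)) - monom_val (expo I) (($) (x - y)) - 2 * monom_val (expo I) (($) y)
        = 2 * monom_diff (expo I) (($) x) (($) y)"
      unfolding d unfolding e by (simp add: monom_val_add monom_val_single algebra_simps)
  qed
  also have "\<dots> = 2 * (\<Sum>i\<in>UNIV. y $ i * ceval (cpderiv i (cubic_form b)) (($) x))"
    unfolding gradient_sum sum_distrib_left by (simp add: mult_ac)
  finally show ?thesis
    by simp
qed

text \<open>Kronecker substitution: on the curve \<open>(t, t\<^sup>4, t\<^sup>1\<^sup>6)\<close> distinct cubic monomials are distinct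
  powers of \<open>t\<close>.\<close>

lemma cubic_val_inject:
  assumes "\<And>x. cubic_val a x = cubic_val b x"
  shows "a = b"
proof -
  define e where "e I = Poly_Mapping.lookup (expo I) 1 + 4 * Poly_Mapping.lookup (expo I) 2
    + 16 * Poly_Mapping.lookup (expo I) 3" for I
  have e_inj: "e I = e J \<longleftrightarrow> I = J" for I J
  proof
    assume eq: "e I = e J"
    let ?l = "\<lambda>I. Poly_Mapping.lookup (expo I)"
    have 3: "?l K 1 + ?l K 2 + ?l K 3 = 3" for K
      using expo[of K] by (simp add: sum_3)
    \<comment> \<open>The two lower digits contribute at most 12, less than 16, so the top digit is
      determined first.\<close>
    have "?l I 3 = ?l J 3"
      using 3[of I] 3[of J] eq unfolding e_def by linarith
    moreover from this have "?l I 2 = ?l J 2"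
      using 3[of I] 3[of J] eq unfolding e_def by linarith
    moreover from calculation have "?l I 1 = ?l J 1"
      using 3[of I] 3[of J] by linarith
    ultimately have "?l I i = ?l J i" for i
      using exhaust_3[of i] by auto
    then have "expo I = expo J"
      by (rule poly_mapping_eqI)
    then show "I = J"
      by (simp add: expo_inject)
  qed simp
  define P where "P = (\<Sum>I\<in>UNIV. Polynomial.monom (a $ I - b $ I) (e I))"
  have "poly P t = 0" for t
  proof -
    define x :: "complex^3" where "x = vector [t, t^4, t^16]"
    have m: "monom_val (expo I) (($) x) = t ^ e I" for I
    proof -
      have "monom_val (expo I) (($) x) = (\<Prod>v\<in>UNIV. x $ v ^ Poly_Mapping.lookup (expo I) v)"
        by (rule monom_val_superset) auto
      also have "\<dots> = t ^ e I"
        unfolding UNIV_3 x_def e_def power_add power_mult by (simp add: mult.assoc)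
      finally show ?thesis .
    qed
    have "poly P t = cubic_val a x - cubic_val b x"
      by (simp add: P_def poly_sum poly_monom cubic_val_sum m left_diff_distrib sum_subtractf)
    then show ?thesis
      using assms by simp
  qed
  then have "P = 0"
    by (metis poly_all_0_iff_0)
  have "a $ I - b $ I = 0" for I
  proof -
    have "coeff P (e I) = a $ I - b $ I"
      by (simp add: P_def coeff_sum e_inj)
    then show ?thesis
      using \<open>P = 0\<close> by simp
  qed
  then show ?thesis
    by (simp add: vec_eq_iff)
qed

section \<open>The actions and smoothness in terms of values and polar forms\<close>

lemma cubic_val_SL3_act:
  "cubic_val (SL3_act g b) x = cubic_val b (matrix_inv g *v x)"
proof -
  let ?L = "\<lambda>i. \<Sum>j\<in>UNIV. cconst (matrix_inv g $ i $ j) * cvar j :: 3 cpoly"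
  have "homogeneous 1 (?L i)" for i
    using homogeneous_mult[OF homogeneous_cconst homogeneous_cvar] by (intro homogeneous_sum) simp
  then have "homogeneous 3 (csubst (cubic_form b) ?L)"
    by (intro homogeneous_csubst homogeneous_cubic_form)
  then have "cubic_val (SL3_act g b) x = ceval (csubst (cubic_form b) ?L) (($) x)"
    unfolding SL3_act_def by (simp add: cubic_form_cubic_coeffs)
  also have "\<dots> = ceval (cubic_form b) (\<lambda>i. (matrix_inv g *v x) $ i)"
    by (simp add: ceval_csubst matrix_vector_mult_def)
  finally show ?thesis .
qed

lemma cubic_val_sl3_act:
  assumes "sym_trilinear F" "\<And>x. F x x x = cubic_val b x"
  shows "cubic_val (sl3_act \<xi> b) x = - 3 * F x x (\<xi> *v x)"
proof -
  let ?P = "- (\<Sum>i\<in>UNIV. \<Sum>j\<in>UNIV. cconst (\<xi> $ i $ j) * cvar j * cpderiv i (cubic_form b))"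
  have "homogeneous 2 (cpderiv i (cubic_form b))" for i
    using homogeneous_cubic_form[of b] by (intro homogeneous_cpderiv) (simp add: numeral_3_eq_3 numeral_2_eq_2)
  then have "homogeneous (0 + 1 + 2) (cconst (\<xi> $ i $ j) * cvar j * cpderiv i (cubic_form b))" for i j
    by (intro homogeneous_mult homogeneous_cconst homogeneous_cvar)
  then have "homogeneous 3 ?P"
    by (intro homogeneous_uminus homogeneous_sum) (simp add: numeral_3_eq_3)
  then have "cubic_val (sl3_act \<xi> b) x = ceval ?P (($) x)"
    unfolding sl3_act_def by (simp add: cubic_form_cubic_coeffs)
  also have "\<dots> = - (\<Sum>i\<in>UNIV. (\<xi> *v x) $ i * ceval (cpderiv i (cubic_form b)) (($) x))"
    by (simp add: matrix_vector_mult_def sum_distrib_right)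
  also have "\<dots> = - 3 * F x x (\<xi> *v x)"
    using gradient_unique[OF assms, of x "\<xi> *v x"] by simp
  finally show ?thesis .
qed

text \<open>The Jacobian criterion concerns points on the curve, \<open>nonsingular\<close> all
  nonzero points. Off the curve \<open>v = x\<close> already gives
  \<open>F x x v \<noteq> 0\<close>.\<close>

lemma smooth_cubics_iff_nonsingular:
  assumes "sym_trilinear F" "\<And>x. F x x x = cubic_val b x"
  shows "b \<in> smooth_cubics \<longleftrightarrow> nonsingular F"
proof -
  have D: "3 * F x x (axis i 1) = ceval (cpderiv i (cubic_form b)) (($) x)" for x i
    using gradient_unique[OF assms, of x "axis i 1"] by (simp add: axis_def if_distrib[of "\<lambda>z. z * _"] cong: if_cong)
  have "(\<exists>v. F x x v \<noteq> 0) \<longleftrightarrow> (\<exists>i. ceval (cpderiv i (cubic_form b)) (($) x) \<noteq> 0)" for x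
  proof
    assume "\<exists>v. F x x v \<noteq> 0"
    then obtain v where "3 * F x x v \<noteq> 0"
      by auto
    then have "(\<Sum>i\<in>UNIV. v $ i * ceval (cpderiv i (cubic_form b)) (($) x)) \<noteq> 0"
      unfolding gradient_unique[OF assms] .
    then show "\<exists>i. ceval (cpderiv i (cubic_form b)) (($) x) \<noteq> 0"
      by (rule contrapos_np) simp
  next
    assume "\<exists>i. ceval (cpderiv i (cubic_form b)) (($) x) \<noteq> 0"
    then show "\<exists>v. F x x v \<noteq> 0"
      unfolding D[symmetric] by auto
  qed
  then show ?thesis
    unfolding smooth_cubics_def nonsingular_def mem_Collect_eq assms(2)[symmetric] by blast
qed

section \<open>Passing to the special linear group\<close>

lemma mat_mult_vec: "mat k *v x = (k :: complex) *s x"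
  by (simp add: vec_eq_iff matrix_vector_mult_def mat_def if_distrib[of "\<lambda>z. z * _"] cong: if_cong)

lemma trace_mat_mult: "trace (mat k ** A) = (k :: complex) * trace (A :: complex^3^3)"
  by (simp add: trace_def matrix_matrix_mult_def mat_def sum_3 algebra_simps)

text \<open>The coordinate changes \<open>M\<close> and \<open>K\<close> found before are only
  invertible; a scalar factor turns their quotient into an element of \<open>SL3\<close>, and
  \<open>\<eta>\<close> is transported by conjugation, which preserves the trace.\<close>

lemma orbit_meets_tangent_space:
  assumes "b \<in> smooth_cubics"
  obtains g \<xi> where "g \<in> SL3" "SL3_act g b \<in> smooth_cubics" "\<xi> \<in> sl3" "lam = sl3_act \<xi> (SL3_act g b)"
proof -
  obtain F where F: "sym_trilinear F" "\<And>x. F x x x = cubic_val b x"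
    using cubic_polar_form by blast
  obtain H where H: "sym_trilinear H" "\<And>x. H x x x = cubic_val lam x"
    using cubic_polar_form by blast
  have ns: "nonsingular F"
    using assms smooth_cubics_iff_nonsingular[OF F] by blast
  obtain M K \<eta> where M: "det M \<noteq> 0" and K: "det K \<noteq> 0" and \<eta>: "trace \<eta> = 0"
    and eq: "\<And>v. H (K *v v) (K *v v) (K *v v) = 3 * F (M *v v) (M *v v) (M *v (\<eta> *v v))"
    using cubic_meets_tangent_space[OF F(1) ns H(1)] by blast
  \<comment> \<open>Chosen to give \<open>k *s K\<close> the same determinant as
    \<open>M\<close>.\<close>
  obtain k where k: "k^3 = det M / det K"
    using complex_root_exists[of 3] by auto
  obtain M' where M': "M ** M' = mat 1" "M' ** M = mat 1"
    using M invertible_det_nz[of M] unfolding invertible_def by blast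
  define g where "g = mat k ** K ** M'"
  have "det (mat k :: complex^3^3) = k^3"
    by (simp add: det_3 mat_def power3_eq_cube)
  moreover have "det M * det M' = 1"
    using arg_cong[OF M'(1), of det] by (simp add: det_mul)
  ultimately have g: "det g = 1"
    using K by (simp add: g_def det_mul k)
  define G where "G = matrix_inv g"
  have "\<exists>A. g ** A = mat 1 \<and> A ** g = mat 1"
    using g invertible_det_nz[of g] by (simp add: invertible_def)
  then have G: "g ** G = mat 1" "G ** g = mat 1"
    unfolding G_def matrix_inv_def by (metis (mono_tags, lifting) someI_ex)+
  have "det G \<noteq> 0"
    using arg_cong[OF G(2), of det] by (auto simp: det_mul)
  let ?b = "SL3_act g b" and ?F = "\<lambda>u v w. F (G *v u) (G *v v) (G *v w)"
  have F': "sym_trilinear ?F" "\<And>x. ?F x x x = cubic_val ?b x"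
    using sym_trilinear.compose[OF F(1)] by (auto simp: F(2) cubic_val_SL3_act G_def)
  have smooth: "?b \<in> smooth_cubics"
    using smooth_cubics_iff_nonsingular[OF F'] nonsingular_compose[OF ns \<open>det G \<noteq> 0\<close>] by blast
  \<comment> \<open>The factor \<open>k^3\<close> matches the rescaling of the argument of
    \<open>H\<close> by \<open>k\<close>; the minus sign cancels the one in
    \<open>sl3_act\<close>.\<close>
  define \<xi> where "\<xi> = g ** (mat (- (k^3)) ** M ** \<eta> ** M') ** G"
  have "trace \<xi> = trace (G ** (g ** (mat (- (k^3)) ** M ** \<eta> ** M')))"
    unfolding \<xi>_def by (rule trace_mul_sym)
  also have "\<dots> = trace (mat (- (k^3)) ** (M ** \<eta> ** M'))"
    by (simp add: matrix_mul_assoc G)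
  also have "\<dots> = - (k^3) * trace (M ** \<eta> ** M')"
    by (rule trace_mat_mult)
  also have "trace (M ** \<eta> ** M') = trace (M' ** (M ** \<eta>))"
    by (rule trace_mul_sym)
  also have "\<dots> = 0"
    by (simp add: matrix_mul_assoc M' \<eta>)
  finally have "\<xi> \<in> sl3"
    by (simp add: sl3_def)
  moreover have "lam = sl3_act \<xi> ?b"
  proof (rule cubic_val_inject)
    fix x
    interpret F: sym_trilinear F by fact
    interpret H: sym_trilinear H by fact
    \<comment> \<open>The common coordinate vector: \<open>M *v v = G *v x\<close> on the side of
      \<open>F\<close>, and \<open>x = k *s (K *v v)\<close> on the side of
      \<open>H\<close>.\<close>
    define v where "v = M' *v (G *v x)"
    have Mv: "M *v v = G *v x"
      by (simp add: v_def matrix_vector_mul_assoc M' matrix_mul_assoc)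
    have "x = g *v (G *v x)"
      by (simp add: matrix_vector_mul_assoc G)
    also have "\<dots> = k *s (K *v v)"
      by (simp add: g_def v_def mat_mult_vec flip: matrix_vector_mul_assoc)
    finally have x: "x = k *s (K *v v)" .
    have "cubic_val lam x = k^3 * H (K *v v) (K *v v) (K *v v)"
      unfolding H(2)[symmetric] by (subst (1 2 3) x) (simp add: H.expand power3_eq_cube)
    also have "\<dots> = 3 * k^3 * F (G *v x) (G *v x) (M *v (\<eta> *v v))"
      unfolding eq Mv by simp
    also have "\<dots> = - 3 * F (G *v x) (G *v x) ((- (k^3)) *s (M *v (\<eta> *v v)))"
      unfolding F.scale3 by simp
    also have "(- (k^3)) *s (M *v (\<eta> *v v)) = (mat (- (k^3)) ** M ** \<eta> ** M') *v (G *v x)"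
      by (simp add: v_def mat_mult_vec flip: matrix_vector_mul_assoc)
    also have "\<dots> = G *v (\<xi> *v x)"
      by (simp add: \<xi>_def matrix_vector_mul_assoc matrix_mul_assoc G)
    also have "- 3 * F (G *v x) (G *v x) \<dots> = cubic_val (sl3_act \<xi> ?b) x"
      by (rule cubic_val_sl3_act[OF F', symmetric])
    finally show "cubic_val lam x = cubic_val (sl3_act \<xi> ?b) x" .
  qed
  ultimately show thesis
    using that g smooth by (simp add: SL3_def)
qed

text \<open>At the point \<open>b\<close> the operator coincides with the vector field of
  \<open>\<xi>\<close>, which annihilates every solution.\<close>

lemma tangent_in_diff_zeros:
  assumes "b \<in> smooth_cubics" "\<xi> \<in> sl3"
  shows "b \<in> diff_zeros (const_op (sl3_act \<xi> b))"
proof -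
  have "const_op (sl3_act \<xi> b) s b = 0" if s: "s \<in> sol_stalk b" for s
  proof -
    obtain U where "b \<in> U" "s \<in> sol U"
      using s unfolding sol_stalk_def by auto
    then show ?thesis
      using assms(2) unfolding sol_def const_op_def by auto
  qed
  then show ?thesis
    using assms(1) by (simp add: diff_zeros_def)
qed

lemma smooth_cubics_nonempty: "smooth_cubics \<noteq> {}"
proof -
  define F where "F u v w = (\<Sum>i\<in>UNIV. u $ i * v $ i * w $ i)" for u v w :: "complex^3"
  have "sym_trilinear F"
    by unfold_locales (simp_all add: F_def algebra_simps sum.distrib sum_distrib_left)
  \<comment> \<open>The Fermat cubic, with polar form \<open>F\<close>.\<close>
  define p :: "3 cpoly" where "p = (\<Sum>i\<in>UNIV. cvar i * cvar i * cvar i)"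
  have "homogeneous (1 + 1 + 1) p"
    unfolding p_def by (intro homogeneous_sum homogeneous_mult homogeneous_cvar)
  then have "homogeneous 3 p"
    by (simp add: numeral_3_eq_3)
  then have "F x x x = cubic_val (cubic_coeffs p) x" for x
    by (simp add: cubic_form_cubic_coeffs) (simp add: F_def p_def)
  moreover have "nonsingular F"
    unfolding nonsingular_def
  proof (intro allI impI)
    fix x :: "complex^3"
    assume "x \<noteq> 0"
    then obtain i where "x $ i \<noteq> 0"
      by (auto simp: vec_eq_iff)
    then show "\<exists>v. F x x v \<noteq> 0"
      by (intro exI[of _ "axis i 1"]) (simp add: F_def axis_def if_distrib[of "\<lambda>z. _ * z"] cong: if_cong)
  qed
  ultimately show ?thesis
    using smooth_cubics_iff_nonsingular[OF \<open>sym_trilinear F\<close>] by blast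
qed

theorem proposition7p22:
  fixes lam :: cubic_space
  assumes "git_stable lam"
  shows "(\<forall>b\<in>smooth_cubics. diff_zeros (const_op lam) \<inter> SL3_orbit b \<noteq> {}) \<and>
         diff_zeros (const_op lam) \<noteq> {}"
proof -
  have "diff_zeros (const_op lam) \<inter> SL3_orbit b \<noteq> {}" if b: "b \<in> smooth_cubics" for b
  proof -
    obtain g \<xi> where "g \<in> SL3" "SL3_act g b \<in> smooth_cubics" "\<xi> \<in> sl3" "lam = sl3_act \<xi> (SL3_act g b)"
      using orbit_meets_tangent_space[OF b] .
    then have "SL3_act g b \<in> diff_zeros (const_op lam) \<inter> SL3_orbit b"
      using tangent_in_diff_zeros by (auto simp: SL3_orbit_def)
    then show ?thesis by blast
  qed
  then show ?thesis
    using smooth_cubics_nonempty by blast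
qed

end
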